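(* Let $f,c,\mathcal{A}$ satisfy the standing assumptions stated in the context, let $x\in\mathcal{M}=\{x\in\mathbb{R}^n: c(x)=0\}$, and suppose $\beta>\tilde\beta_x$. Then every $y\in\Omega_x$ that is a first-order stationary point of the constraint dissolving function $h(y)=f(\mathcal{A}(y))+\frac{\beta}{2}\|c(y)\|^2$ is a first-order stationary point of the constrained problem $\min\{f(x): x\in\mathbb{R}^n,\ c(x)=0\}$.
   Context: **Setting and standing assumptions.** $\|\cdot\|$ is the Euclidean norm of vectors or the spectral norm of matrices; $\sigma_s(\cdot)$ is the $s$-th largest singular value. $f:\mathbb{R}^n\to\mathbb{R}$ is locally Lipschitz continuous and differentiable. $c:\mathbb{R}^n\to\mathbb{R}^p$ is differentiable and its transposed Jacobian $J_c(x)\in\mathbb{R}^{n\times p}$ (entries $(J_c(x))_{ij}=\partial c_j/\partial x_i$) is locally Lipschitz continuous. $\mathcal{M}:=\{x\in\mathbb{R}^n:c(x)=0\}$. There are an integer $1\le p'\le p$ and a neighborhood $\mathcal{X}$ of $\mathcal{M}$ such that $\operatorname{rank}J_c(x)=p'$ for all $x\in\mathcal{X}$ (relaxed constant rank constraint qualification). $\mathcal{A}:\mathbb{R}^n\to\mathbb{R}^n$ is differentiable with locally Lipschitz transposed Jacobian $J_{\mathcal{A}}(x)\in\mathbb{R}^{n\times n}$ (entries $\partial\mathcal{A}_j/\partial x_i$), $\mathcal{A}(x)=x$ for all $x\in\mathcal{M}$, and $J_{\mathcal{A}}(x)J_c(x)=0$ for all $x\in\mathcal{M}$. $\nabla f(\mathcal{A}(y))$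 means $\nabla f(z)|_{z=\mathcal{A}(y)}$, and $\mathcal{A}^2(y)=\mathcal{A}(\mathcal{A}(y))$. **Constants.** For $x\in\mathcal{M}$, let $\rho_x$ be the largest $\rho\in(0,1]$ such that the open ball $\mathcal{B}_{x,\rho}$ of center $x$ and radius $\rho$ is contained in $\mathcal{X}$ and $\inf\{\sigma_{p'}(J_c(y)):y\in\mathcal{B}_{x,\rho}\}\ge\frac12\sigma_{p'}(J_c(x))$. Let $\Theta_x:=\{y:\|y-x\|\le\rho_x\}$ and $\sigma_{x,c}:=\sigma_{p'}(J_c(x))$; $M_{x,c}:=\sup_{y\in\Theta_x}\|J_c(y)\|$; $M_{x,A}:=\sup_{y\in\Theta_x}\|J_{\mathcal{A}}(y)\|$; and let $L_{x,c}$, $L_{x,A}$, $L_{x,b}$ be the suprema over $y\ne z$ in $\Theta_x$ of, respectively, $\frac{\|J_c(y)-J_c(z)\|}{\|y-z\|}$, $\frac{\|J_{\mathcal{A}}(y)-J_{\mathcal{A}}(z)\|}{\|y-z\|}$, $\frac{\|J_{\mathcal{A}}(y)J_c(\mathcal{A}(y))-J_{\mathcal{A}}(z)J_c(\mathcal{A}(z))\|}{\|y-z\|}$. Set $$\varepsilon_x:=\min\Big\{\frac{\rho_x}{2},\ \frac{\sigma_{x,c}}{32L_{x,c}(M_{x,A}+1)},\ \frac{\sigma_{x,c}^2}{8(L_{x,b}+L_{x,c})M_{x,c}},\ \frac{\sigma_{x,c}}{5(L_{x,b}+L_{x,A}M_{x,c})}\Big\}$$ (a fraction with zero denominator is read as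 $+\infty$), and $\Omega_x:=\{y\in\mathbb{R}^n:\|y-x\|\le\varepsilon_x\}$. **Threshold.** $$\tilde\beta_x:=\sup_{y\in\Omega_x}\max\Big\{\frac{2(f(\mathcal{A}^2(y))-f(\mathcal{A}(y)))}{\|c(y)\|^2-\|c(\mathcal{A}(y))\|^2},\ \frac{(\mathcal{A}(y)-y)^\top J_{\mathcal{A}}(y)\nabla f(\mathcal{A}(y))}{(y-\mathcal{A}(y))^\top J_c(y)c(y)},\ 0\Big\},$$ with the convention $0/0:=0$ (which occurs for $y\in\mathcal{M}$). **Stationarity.** $y$ is a first-order stationary point of the constrained problem if $c(y)=0$ and there is $\tilde\lambda\in\mathbb{R}^p$ with $\nabla f(y)-\sum_{i=1}^p\tilde\lambda_i\nabla c_i(y)=0$. $y$ is a first-order stationary point of $h$ if $\nabla h(y)=0$. *)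

theory Defs
  imports "HOL-Analysis.Analysis" "HOL-Library.Multiset"
begin

definition grad :: "(real^'n \<Rightarrow> real) \<Rightarrow> real^'n \<Rightarrow> real^'n" where
  "grad f x = (\<chi> i. frechet_derivative f (at x) (axis i 1))"

text \<open>Transposed Jacobian: the entry in row \<open>i\<close> and column \<open>j\<close> is the partial derivative of the
  \<open>j\<close>-th component with respect to the \<open>i\<close>-th variable.\<close>

definition tjac :: "(real^'n \<Rightarrow> real^'p) \<Rightarrow> real^'n \<Rightarrow> real^'p^'n" where
  "tjac c x = transpose (jacobian c (at x))"

text \<open>Here \<open>norm\<close> on matrices is the Frobenius norm; since all norms on a finite-dimensional space
  are equivalent, this does not affect the notion.\<close>

definition locally_lipschitz :: "('a::metric_space \<Rightarrow> 'b::metric_space) \<Rightarrow> bool" where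
  "locally_lipschitz F \<longleftrightarrow> (\<forall>x. \<exists>r>0. \<exists>L. L-lipschitz_on (ball x r) F)"

definition spectral_norm :: "real^'p^'n \<Rightarrow> real" where
  "spectral_norm B = onorm ((*v) B)"

definition eigenspace :: "real^'p^'p \<Rightarrow> real \<Rightarrow> (real^'p) set" where
  "eigenspace S t = {v. S *v v = t *\<^sub>R v}"

text \<open>Singular values of \<open>B\<close>: the square roots of the eigenvalues of \<open>transpose B ** B\<close> in decreasing
  order, each repeated according to its multiplicity (for a symmetric matrix, the dimension of the
  eigenspace). An \<open>n \<times> p\<close> matrix gets \<open>p\<close> entries here; when \<open>n < p\<close> the last \<open>p - n\<close> are zero.\<close>

definition singular_values :: "real^'p^'n \<Rightarrow> real list" where
  "singular_values B =
     rev (sorted_list_of_multiset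
       (\<Sum>s\<in>{s. 0 \<le> s \<and> eigenspace (transpose B ** B) (s\<^sup>2) \<noteq> {0}}.
          replicate_mset (dim (eigenspace (transpose B ** B) (s\<^sup>2))) s))"

text \<open>The \<open>s\<close>-th largest singular value, counting from 1.\<close>

definition sing_val :: "nat \<Rightarrow> real^'p^'n \<Rightarrow> real" where
  "sing_val s B = singular_values B ! (s - 1)"

definition feasible :: "(real^'n \<Rightarrow> real^'p) \<Rightarrow> (real^'n) set" where
  "feasible c = {x. c x = 0}"

definition rho :: "(real^'n \<Rightarrow> real^'p) \<Rightarrow> (real^'n) set \<Rightarrow> nat \<Rightarrow> real^'n \<Rightarrow> real" where
  "rho c X p' x = (GREATEST r. 0 < r \<and> r \<le> 1 \<and> ball x r \<subseteq> X \<and>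
      (INF y\<in>ball x r. sing_val p' (tjac c y)) \<ge> sing_val p' (tjac c x) / 2)"

definition Theta :: "(real^'n \<Rightarrow> real^'p) \<Rightarrow> (real^'n) set \<Rightarrow> nat \<Rightarrow> real^'n \<Rightarrow> (real^'n) set" where
  "Theta c X p' x = {y. norm (y - x) \<le> rho c X p' x}"

text \<open>For the continuous, respectively locally Lipschitz, matrix functions and the compact convex set
  \<open>Theta c X p' x\<close> these are used with, the following real suprema are finite.\<close>

definition sup_norm_on :: "(real^'n) set \<Rightarrow> (real^'n \<Rightarrow> real^'q^'m) \<Rightarrow> real" where
  "sup_norm_on S F = (SUP y\<in>S. spectral_norm (F y))"

definition lip_const_on :: "(real^'n) set \<Rightarrow> (real^'n \<Rightarrow> real^'q^'m) \<Rightarrow> real" where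
  "lip_const_on S F =
     (SUP (y, z)\<in>{(y, z). y \<in> S \<and> z \<in> S \<and> y \<noteq> z}. spectral_norm (F y - F z) / norm (y - z))"

text \<open>Division is done in \<^typ>\<open>ereal\<close>, where a positive number divided by \<open>0\<close> is \<open>\<infinity>\<close>; the numerators
  are positive because \<open>p'\<close> is the rank of \<open>tjac c x\<close>.\<close>

definition eps ::
  "(real^'n \<Rightarrow> real^'p) \<Rightarrow> (real^'n \<Rightarrow> real^'n) \<Rightarrow> (real^'n) set \<Rightarrow> nat \<Rightarrow> real^'n \<Rightarrow> ereal" where
  "eps c A X p' x =
    (let T = Theta c X p' x;
         \<sigma> = sing_val p' (tjac c x);
         Mc = sup_norm_on T (tjac c);
         MA = sup_norm_on T (tjac A);
         Lc = lip_const_on T (tjac c);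
         LA = lip_const_on T (tjac A);
         Lb = lip_const_on T (\<lambda>y. tjac A y ** tjac c (A y))
     in Min {ereal (rho c X p' x / 2),
             ereal \<sigma> / ereal (32 * Lc * (MA + 1)),
             ereal (\<sigma>\<^sup>2) / ereal (8 * (Lb + Lc) * Mc),
             ereal \<sigma> / ereal (5 * (Lb + LA * Mc))})"

definition Omega ::
  "(real^'n \<Rightarrow> real^'p) \<Rightarrow> (real^'n \<Rightarrow> real^'n) \<Rightarrow> (real^'n) set \<Rightarrow> nat \<Rightarrow> real^'n \<Rightarrow> (real^'n) set" where
  "Omega c A X p' x = {y. ereal (norm (y - x)) \<le> eps c A X p' x}"

text \<open>In \<^typ>\<open>ereal\<close>, \<open>0 / 0 = 0\<close>. The supremum is not presupposed to be finite.\<close>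

definition beta_threshold ::
  "(real^'n \<Rightarrow> real) \<Rightarrow> (real^'n \<Rightarrow> real^'p) \<Rightarrow> (real^'n \<Rightarrow> real^'n) \<Rightarrow> (real^'n) set \<Rightarrow> nat \<Rightarrow>
     real^'n \<Rightarrow> ereal" where
  "beta_threshold f c A X p' x =
     (SUP y\<in>Omega c A X p' x. Max
        {ereal (2 * (f (A (A y)) - f (A y))) / ereal ((norm (c y))\<^sup>2 - (norm (c (A y)))\<^sup>2),
         ereal ((A y - y) \<bullet> (tjac A y *v grad f (A y))) / ereal ((y - A y) \<bullet> (tjac c y *v c y)),
         0})"

definition constraint_dissolving ::
  "(real^'n \<Rightarrow> real) \<Rightarrow> (real^'n \<Rightarrow> real^'p) \<Rightarrow> (real^'n \<Rightarrow> real^'n) \<Rightarrow> real \<Rightarrow> real^'n \<Rightarrow> real" where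
  "constraint_dissolving f c A \<beta> y = f (A y) + \<beta> / 2 * (norm (c y))\<^sup>2"

definition constrained_stationary ::
  "(real^'n \<Rightarrow> real) \<Rightarrow> (real^'n \<Rightarrow> real^'p) \<Rightarrow> real^'n \<Rightarrow> bool" where
  "constrained_stationary f c y \<longleftrightarrow>
     c y = 0 \<and>
     (\<exists>l::real^'p. grad f y - (\<Sum>i\<in>UNIV. (l $ i) *\<^sub>R grad (\<lambda>z. c z $ i) y) = 0)"

definition stationary :: "(real^'n \<Rightarrow> real) \<Rightarrow> real^'n \<Rightarrow> bool" where
  "stationary h y \<longleftrightarrow> grad h y = 0"

end

theory Submission
  imports Defs
begin

text \<open>A stationary point \<open>y\<close> of the constraint dissolving function satisfies
\<open>tjac A y *v grad f (A y) + \<beta> *\<^sub>R (tjac c y *v c y) = 0\<close>. There are two things to show: \<open>c y = 0\<close>, and the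
existence of multipliers.

Feasibility. Pairing the equation with \<open>A y - y\<close> gives
\<open>(A y - y) \<bullet> (tjac A y *v grad f (A y)) = \<beta> ((y - A y) \<bullet> (tjac c y *v c y))\<close>. If the factor after \<open>\<beta>\<close> is
positive, one of the quotients in the definition of the threshold equals \<open>\<beta>\<close>, contrary to \<open>\<beta>\<close> being larger than
their supremum. The work is therefore to prove that this factor is positive at every infeasible point of the
neighbourhood (\<open>descent_pairing_positive\<close>). Take a nearest feasible point \<open>z\<close>, at distance \<open>d\<close>. The vector
\<open>y - z\<close> is normal to the feasible set, hence in the column space of \<open>tjac c z\<close>, where the transpose stretches
by at least the smallest nonzero singular value; so \<open>norm (c y)\<close> is bounded below by a multiple of \<open>d\<close>.
Because \<open>A z = z\<close> and the derivative of \<open>A\<close> at \<open>z\<close> takes values in the kernel of \<open>transpose (tjac c z)\<close>,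
\<open>A y - z\<close> is tangential up to order \<open>d\<^sup>2\<close>, so that \<open>transpose (tjac c y) *v (y - A y)\<close> agrees with \<open>c y\<close> up to order \<open>d\<^sup>2\<close>. The constants in the radius
of the neighbourhood make the quadratic error smaller than \<open>norm (c y)\<close>.

Multipliers. At a feasible \<open>y\<close> the equation becomes \<open>tjac A y *v grad f y = 0\<close>. As \<open>A\<close> is the identity on the
feasible set, \<open>transpose (tjac A y)\<close> is the identity on its tangent vectors, so \<open>grad f y\<close> is orthogonal to
them and hence a combination of the constraint gradients.

Both halves use that every vector in the kernel of \<open>transpose (tjac c z)\<close> is the velocity of a curve of feasible
points; this is the form of the constant rank theorem proved in \<open>constant_rank_tangent_curve\<close>. The
definition of the singular values through eigenspaces is connected with stretching factors by an orthonormal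
eigenbasis of the Gram matrix (\<open>right_singular_basis_exists\<close>, \<open>mset_singular_values\<close>), from which the two
facts used about them follow: \<open>sing_val_rank_range\<close>, the lower bound on the column space, and
\<open>sing_val_ge_of_subspace\<close>, which makes the radius \<^const>\<open>rho\<close> well defined.\<close>

section \<open>Spectral decomposition of symmetric operators\<close>

text \<open>A maximiser \<open>v\<close> of the Rayleigh quotient on the unit sphere of \<open>U\<close> is an eigenvector: with \<open>l\<close> the
maximum, the quadratic form \<open>q w = l (w \<bullet> w) - w \<bullet> T w\<close> is nonnegative on \<open>U\<close> and vanishes at \<open>v\<close>, so its
derivative at \<open>v\<close> in every direction \<open>w\<close> of \<open>U\<close>, which is \<open>2 ((l v - T v) \<bullet> w)\<close>, is zero.\<close>

lemma selfadjoint_has_eigenvector: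
  fixes T :: "'a::euclidean_space \<Rightarrow> 'a"
  assumes lin: "linear T" and sa: "\<And>u v. T u \<bullet> v = u \<bullet> T v"
    and U: "subspace U" "T ` U \<subseteq> U" "U \<noteq> {0}"
  obtains v l where "v \<in> U" "norm v = 1" "T v = l *\<^sub>R v"
proof -
  let ?S = "U \<inter> sphere 0 1"
  obtain u where u: "u \<in> U" "u \<noteq> 0"
    using U subspace_0 by blast
  have "inverse (norm u) *\<^sub>R u \<in> ?S"
    using u U by (simp add: subspace_mul)
  moreover have "compact ?S"
    using closed_subspace[OF U(1)] by (simp add: closed_Int_compact)
  moreover have "continuous_on ?S (\<lambda>v. v \<bullet> T v)"
    by (intro continuous_intros linear_continuous_on_compose[OF continuous_on_id lin])
  ultimately obtain v where v: "v \<in> ?S" and vmax: "\<And>w. w \<in> ?S \<Longrightarrow> w \<bullet> T w \<le> v \<bullet> T v"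
    using continuous_attains_sup[of ?S "\<lambda>v. v \<bullet> T v"] by blast
  define l where "l = v \<bullet> T v"
  define q where "q w = l * (w \<bullet> w) - w \<bullet> T w" for w
  have vU: "v \<in> U" and nv: "norm v = 1" using v by auto
  have q_nonneg: "0 \<le> q w" if "w \<in> U" for w
  proof (cases "w = 0")
    case False
    let ?w = "inverse (norm w) *\<^sub>R w"
    have "?w \<bullet> T ?w \<le> l"
      unfolding l_def using vmax[of ?w] that False U(1) by (simp add: subspace_mul)
    then have "(w \<bullet> T w) / (norm w)\<^sup>2 \<le> l"
      by (simp add: linear_scale[OF lin] power2_eq_square divide_inverse mult.commute mult.left_commute)
    then show ?thesis
      using False by (simp add: q_def pos_divide_le_eq dot_square_norm mult.commute)
  qed (simp add: q_def linear_0[OF lin])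
  have ortho: "(l *\<^sub>R v - T v) \<bullet> w = 0" if w: "w \<in> U" for w
  proof (rule ccontr)
    define b where "b = (l *\<^sub>R v - T v) \<bullet> w"
    assume "(l *\<^sub>R v - T v) \<bullet> w \<noteq> 0"
    then have b: "b \<noteq> 0" by (simp add: b_def)
    have expand: "q (v + t *\<^sub>R w) = 2 * t * b + t\<^sup>2 * q w" for t
    proof -
      have "w \<bullet> T v = v \<bullet> T w" by (metis sa inner_commute)
      moreover have "v \<bullet> v = 1" using nv by (simp add: dot_square_norm)
      ultimately show ?thesis
        unfolding q_def b_def
        by (simp add: linear_add[OF lin] linear_scale[OF lin] inner_add_left inner_add_right
            inner_diff_left inner_commute[of w v] inner_commute[of "T v" w] l_def algebra_simps
            power2_eq_square)
    qed
    have pos: "0 \<le> 2 * t * b + t\<^sup>2 * q w" for t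
      using q_nonneg[of "v + t *\<^sub>R w"] vU w U(1) expand by (simp add: subspace_add subspace_mul)
    define K where "K = q w + 1"
    have K: "K > 0" using q_nonneg[OF w] by (simp add: K_def)
    \<comment> \<open>A step against the slope \<open>b\<close> that is short compared with the curvature \<open>q w\<close> makes \<open>q\<close> negative.\<close>
    have "2 * (- b / K) * b + (- b / K)\<^sup>2 * q w = (b\<^sup>2 / K\<^sup>2) * (q w - 2 * K)"
      using K by (simp add: field_simps power2_eq_square)
    also have "\<dots> < 0"
      using b K q_nonneg[OF w] by (intro mult_pos_neg) (auto simp: K_def)
    finally show False using pos[of "- b / K"] by simp
  qed
  have "l *\<^sub>R v - T v \<in> U"
    using vU U by (auto simp: subspace_diff subspace_mul)
  then have "T v = l *\<^sub>R v"
    using ortho[of "l *\<^sub>R v - T v"] by simp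
  then show thesis using that vU nv by blast
qed

text \<open>The induction splits off one eigenvector and continues on its orthogonal complement in \<open>U\<close>, which is
again invariant; this is why the statement is about invariant subspaces and not only the whole space.\<close>

lemma selfadjoint_orthonormal_eigenbasis:
  fixes T :: "'a::euclidean_space \<Rightarrow> 'a"
  assumes lin: "linear T" and sa: "\<And>u v. T u \<bullet> v = u \<bullet> T v"
    and "subspace U" "T ` U \<subseteq> U"
  shows "\<exists>E. pairwise orthogonal E \<and> (\<forall>e\<in>E. norm e = 1) \<and> span E = U \<and>
           (\<forall>e\<in>E. \<exists>l. T e = l *\<^sub>R e)"
  using assms(3,4)
proof (induction "dim U" arbitrary: U rule: less_induct)
  case less
  show ?case
  proof (cases "U = {0}")
    case True
    then show ?thesis by (intro exI[of _ "{}"]) (simp add: pairwise_def)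
  next
    case False
    then obtain v l where v: "v \<in> U" "norm v = 1" "T v = l *\<^sub>R v"
      using selfadjoint_has_eigenvector[OF lin sa less.prems] by blast
    have vv: "v \<bullet> v = 1" using v by (simp add: dot_square_norm)
    define U' where "U' = U \<inter> {u. v \<bullet> u = 0}"
    have U': "subspace U'"
      unfolding U'_def by (intro subspace_inter less.prems subspace_hyperplane)
    have inv: "T ` U' \<subseteq> U'"
    proof safe
      fix u assume "u \<in> U'"
      then show "T u \<in> U'"
        using less.prems(2) sa[of v u] v(3) by (auto simp: U'_def)
    qed
    have "U' \<noteq> U" using v(1) vv by (force simp: U'_def)
    then have "dim U' < dim U"
      using U' less.prems(1) dim_psubset[of U' U] by (auto simp: U'_def span_eq_iff[THEN iffD2])
    from less.hyps[OF this U' inv] obtain E where E: "pairwise orthogonal E" "\<forall>e\<in>E. norm e = 1"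
      "span E = U'" "\<forall>e\<in>E. \<exists>l. T e = l *\<^sub>R e" by blast
    have Esub: "e \<in> E \<Longrightarrow> v \<bullet> e = 0 \<and> e \<in> U" for e
      using E(3) span_base[of e E] by (auto simp: U'_def)
    have "span (insert v E) = U"
    proof
      show "span (insert v E) \<subseteq> U"
        using Esub v less.prems(1) by (intro span_minimal) auto
      show "U \<subseteq> span (insert v E)"
      proof
        fix u assume u: "u \<in> U"
        have "u - (v \<bullet> u) *\<^sub>R v \<in> span E"
          unfolding E(3) U'_def
          using u v less.prems(1) vv by (auto simp: inner_diff_right subspace_diff subspace_mul)
        then show "u \<in> span (insert v E)"
          unfolding span_insert by blast
      qed
    qed
    moreover have "pairwise orthogonal (insert v E)"
      using E(1) Esub by (auto simp: pairwise_insert orthogonal_def inner_commute)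
    ultimately show ?thesis
      using E v by (intro exI[of _ "insert v E"]) auto
  qed
qed

section \<open>Singular values\<close>

text \<open>Derivatives below are transposes of \<^term>\<open>tjac\<close>, so products with a transpose are kept as they
are and moved across inner products by \<open>transpose_inner\<close>.\<close>

declare transpose_matrix_vector [simp del]

lemma transpose_inner:
  fixes B :: "real^'p^'n"
  shows "(transpose B *v v) \<bullet> u = v \<bullet> (B *v u)"
  by (simp add: transpose_matrix_vector dot_lmul_matrix)

text \<open>An orthonormal basis of right singular vectors. The eigenvalue belonging to \<open>e\<close> is written as the square
of \<open>norm (B *v e)\<close>, so that these norms are the singular values themselves.\<close>

definition right_singular_basis :: "real^'p^'n \<Rightarrow> (real^'p) set \<Rightarrow> bool" where
  "right_singular_basis B E \<longleftrightarrow>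
     finite E \<and> pairwise orthogonal E \<and> (\<forall>e\<in>E. norm e = 1) \<and> span E = UNIV \<and>
     (\<forall>e\<in>E. transpose B *v (B *v e) = (norm (B *v e))\<^sup>2 *\<^sub>R e)"

lemma right_singular_basis_exists:
  fixes B :: "real^'p^'n"
  obtains E where "right_singular_basis B E"
proof -
  let ?T = "\<lambda>u. transpose B *v (B *v u)"
  have "linear ?T"
    by (intro linear_compose[of "(*v) B" "(*v) (transpose B)", unfolded o_def]) auto
  moreover have "?T u \<bullet> v = u \<bullet> ?T v" for u v
    by (metis transpose_inner inner_commute)
  ultimately obtain E where E: "pairwise orthogonal E" "\<forall>e\<in>E. norm e = 1" "span E = UNIV"
      "\<forall>e\<in>E. \<exists>l. ?T e = l *\<^sub>R e"
    using selfadjoint_orthonormal_eigenbasis[of ?T UNIV] by auto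
  have "?T e = (norm (B *v e))\<^sup>2 *\<^sub>R e" if e: "e \<in> E" for e
  proof -
    obtain l where l: "?T e = l *\<^sub>R e" using E(4) e by blast
    have "l = ?T e \<bullet> e" using l E(2) e by (simp add: dot_square_norm)
    also have "\<dots> = (norm (B *v e))\<^sup>2" by (simp add: transpose_inner dot_square_norm)
    finally show ?thesis using l by simp
  qed
  moreover have "finite E"
    using E pairwise_orthogonal_independent[of E] independent_imp_finite by force
  ultimately show thesis using that E unfolding right_singular_basis_def by blast
qed

context
  fixes B :: "real^'p^'n" and E :: "(real^'p) set"
  assumes E: "right_singular_basis B E"
begin

lemma rsb_finite: "finite E"
  and rsb_eigen: "e \<in> E \<Longrightarrow> transpose B *v (B *v e) = (norm (B *v e))\<^sup>2 *\<^sub>R e"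
  and rsb_inner: "e \<in> E \<Longrightarrow> e' \<in> E \<Longrightarrow> e \<bullet> e' = (if e = e' then 1 else 0)"
  using E unfolding right_singular_basis_def pairwise_def orthogonal_def
  by (auto simp: dot_square_norm)

lemma rsb_independent: "F \<subseteq> E \<Longrightarrow> independent F"
  using E unfolding right_singular_basis_def
  by (intro pairwise_orthogonal_independent) (force intro: pairwise_subset)+

lemma rsb_dim: "F \<subseteq> E \<Longrightarrow> dim (span F) = card F"
  using rsb_independent by (simp add: dim_eq_card_independent)

lemma rsb_card: "card E = CARD('p)"
  using rsb_dim[of E] E unfolding right_singular_basis_def by (simp add: dim_UNIV[where 'a="real^'p"])

lemma rsb_expand: "(\<Sum>e\<in>E. (u \<bullet> e) *\<^sub>R e) = u"
  using E unfolding right_singular_basis_def by (intro orthonormal_basis_expand) auto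

lemma rsb_norm_sum: "(norm (\<Sum>e\<in>E. a e *\<^sub>R e))\<^sup>2 = (\<Sum>e\<in>E. (a e)\<^sup>2)"
proof -
  have "(norm (\<Sum>e\<in>E. a e *\<^sub>R e))\<^sup>2 = (\<Sum>e\<in>E. \<Sum>e'\<in>E. a e * (a e' * (e' \<bullet> e)))"
    unfolding dot_square_norm[symmetric]
    by (simp add: inner_sum_left inner_sum_right sum_distrib_left)
  also have "\<dots> = (\<Sum>e\<in>E. (a e)\<^sup>2)"
  proof (rule sum.cong[OF refl])
    fix e assume e: "e \<in> E"
    have "(\<Sum>e'\<in>E. a e * (a e' * (e' \<bullet> e))) = (\<Sum>e'\<in>E. if e' = e then a e * a e' else 0)"
      using e by (intro sum.cong refl) (auto simp: rsb_inner)
    then show "(\<Sum>e'\<in>E. a e * (a e' * (e' \<bullet> e))) = (a e)\<^sup>2"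
      using e rsb_finite by (simp add: power2_eq_square)
  qed
  finally show ?thesis .
qed

lemma rsb_parseval: "(norm u)\<^sup>2 = (\<Sum>e\<in>E. (u \<bullet> e)\<^sup>2)"
  using rsb_norm_sum[of "\<lambda>e. u \<bullet> e"] by (simp add: rsb_expand)

lemma rsb_gram: "transpose B *v (B *v u) = (\<Sum>e\<in>E. ((u \<bullet> e) * (norm (B *v e))\<^sup>2) *\<^sub>R e)"
proof -
  have "transpose B *v (B *v u) = transpose B *v (B *v (\<Sum>e\<in>E. (u \<bullet> e) *\<^sub>R e))"
    by (simp add: rsb_expand)
  also have "\<dots> = (\<Sum>e\<in>E. (u \<bullet> e) *\<^sub>R (transpose B *v (B *v e)))"
    by (simp only: linear_sum[OF matrix_vector_mul_linear] linear_scale[OF matrix_vector_mul_linear])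
  also have "\<dots> = (\<Sum>e\<in>E. ((u \<bullet> e) * (norm (B *v e))\<^sup>2) *\<^sub>R e)"
    by (intro sum.cong refl) (simp add: rsb_eigen)
  finally show ?thesis .
qed

text \<open>Components along the basis only get scaled by the Gram matrix. From this follow that the eigenspaces are
spanned by basis vectors and that the images of distinct basis vectors are orthogonal.\<close>

lemma rsb_gram_inner: "e \<in> E \<Longrightarrow> (transpose B *v (B *v u)) \<bullet> e = (u \<bullet> e) * (norm (B *v e))\<^sup>2"
proof -
  assume e: "e \<in> E"
  have "(transpose B *v (B *v u)) \<bullet> e = (B *v u) \<bullet> (B *v e)"
    by (simp only: transpose_inner)
  also have "\<dots> = (transpose B *v (B *v e)) \<bullet> u"
    by (metis transpose_inner inner_commute)
  also have "\<dots> = (u \<bullet> e) * (norm (B *v e))\<^sup>2"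
    by (simp only: rsb_eigen[OF e] inner_scaleR_left mult.commute inner_commute[of e])
  finally show ?thesis .
qed

lemma rsb_norm_image: "(norm (B *v u))\<^sup>2 = (\<Sum>e\<in>E. (u \<bullet> e)\<^sup>2 * (norm (B *v e))\<^sup>2)"
proof -
  have "(norm (B *v u))\<^sup>2 = (transpose B *v (B *v u)) \<bullet> u"
    by (simp add: transpose_inner dot_square_norm)
  also have "\<dots> = (\<Sum>e\<in>E. ((u \<bullet> e) * (norm (B *v e))\<^sup>2) * (e \<bullet> u))"
    by (simp only: rsb_gram inner_sum_left inner_scaleR_left)
  also have "\<dots> = (\<Sum>e\<in>E. (u \<bullet> e)\<^sup>2 * (norm (B *v e))\<^sup>2)"
    by (intro sum.cong refl) (simp add: power2_eq_square inner_commute mult_ac)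
  finally show ?thesis .
qed

lemma rsb_mem_span_iff: 
  assumes "F \<subseteq> E" shows "u \<in> span F \<longleftrightarrow> (\<forall>e\<in>E-F. u \<bullet> e = 0)"
proof
  assume "u \<in> span F"
  then show "\<forall>e\<in>E-F. u \<bullet> e = 0"
  proof (induction rule: span_induct)
    case base
    show ?case by (auto simp: subspace_def inner_add_left)
  next
    case (step x)
    then show ?case using assms by (auto simp: rsb_inner)
  qed
next
  assume *: "\<forall>e\<in>E-F. u \<bullet> e = 0"
  have "(\<Sum>e\<in>E. (u \<bullet> e) *\<^sub>R e) = (\<Sum>e\<in>F. (u \<bullet> e) *\<^sub>R e)"
    using * assms rsb_finite by (intro sum.mono_neutral_right) auto
  also have "\<dots> \<in> span F" by (intro span_sum span_scale span_base)
  finally show "u \<in> span F" by (simp add: rsb_expand)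
qed

lemma rsb_eigenspace:
  "eigenspace (transpose B ** B) t = span {e \<in> E. (norm (B *v e))\<^sup>2 = t}"
proof -
  have "transpose B *v (B *v u) = t *\<^sub>R u \<longleftrightarrow> (\<forall>e\<in>E. (norm (B *v e))\<^sup>2 \<noteq> t \<longrightarrow> u \<bullet> e = 0)"
    (is "?L = ?R") for u
  proof
    assume ?L
    show ?R
    proof safe
      fix e assume "e \<in> E" "(norm (B *v e))\<^sup>2 \<noteq> t"
      then show "u \<bullet> e = 0" using rsb_gram_inner[of e u] \<open>?L\<close> by simp
    qed
  next
    assume ?R
    have "transpose B *v (B *v u) = (\<Sum>e\<in>E. t *\<^sub>R ((u \<bullet> e) *\<^sub>R e))"
      unfolding rsb_gram using \<open>?R\<close> by (intro sum.cong refl) auto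
    then show ?L by (simp only: rsb_expand scaleR_sum_right[symmetric])
  qed
  then show ?thesis
    unfolding eigenspace_def matrix_vector_mul_assoc[symmetric]
    by (auto simp: rsb_mem_span_iff)
qed

text \<open>The multiplicity of \<open>s\<close> in the definition, the dimension of the eigenspace of \<open>s\<^sup>2\<close>, is the number of
basis vectors \<open>e\<close> with \<open>norm (B *v e) = s\<close>. Hence questions about the sorted list of singular values become
questions of counting basis vectors.\<close>

lemma mset_singular_values:
  "mset (singular_values B) = image_mset (\<lambda>e. norm (B *v e)) (mset_set E)"
proof -
  let ?g = "\<lambda>e. norm (B *v e)"
  have sq: "{e \<in> E. (?g e)\<^sup>2 = s\<^sup>2} = {e \<in> E. ?g e = s}" if "0 \<le> s" for s
    using that by auto
  have nontrivial: "span {e \<in> E. ?g e = s} \<noteq> {0} \<longleftrightarrow> s \<in> ?g ` E" for s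
  proof -
    let ?F = "{e \<in> E. ?g e = s}"
    have "span ?F = {0} \<longleftrightarrow> dim (span ?F) = 0"
      using span_zero[of ?F] by (auto simp only: dim_eq_0)
    also have "\<dots> \<longleftrightarrow> ?F = {}"
      using rsb_dim[of ?F] rsb_finite by (simp del: dim_span)
    finally show ?thesis by auto
  qed
  have "0 \<le> s \<and> eigenspace (transpose B ** B) (s\<^sup>2) \<noteq> {0} \<longleftrightarrow> s \<in> ?g ` E" for s
  proof (cases "0 \<le> s")
    case True
    then show ?thesis using nontrivial[of s] by (simp only: rsb_eigenspace sq simp_thms)
  qed auto
  then have index: "{s. 0 \<le> s \<and> eigenspace (transpose B ** B) (s\<^sup>2) \<noteq> {0}} = ?g ` E"
    by blast
  have "mset (singular_values B) = (\<Sum>s\<in>?g ` E. replicate_mset (card {e \<in> E. ?g e = s}) s)"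
    unfolding singular_values_def mset_rev mset_sorted_list_of_multiset index
    by (intro sum.cong refl) (auto simp: rsb_eigenspace sq rsb_dim simp del: dim_span)
  also have "\<dots> = image_mset ?g (mset_set E)"
  proof (rule multiset_eqI)
    fix t
    have "count (\<Sum>s\<in>?g ` E. replicate_mset (card {e \<in> E. ?g e = s}) s) t
        = (\<Sum>s\<in>?g ` E. if s = t then card {e \<in> E. ?g e = s} else 0)"
      unfolding count_sum by (intro sum.cong refl) auto
    also have "\<dots> = card {e \<in> E. ?g e = t}"
      using rsb_finite by (auto simp: image_iff)
    also have "\<dots> = count (image_mset ?g (mset_set E)) t"
      using rsb_finite
      by (simp add: count_image_mset vimage_def Int_def conj_commute)
    finally show "count (\<Sum>s\<in>?g ` E. replicate_mset (card {e \<in> E. ?g e = s}) s) t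
        = count (image_mset ?g (mset_set E)) t" .
  qed
  finally show ?thesis .
qed

lemma card_singular_values: "length (filter P (singular_values B)) = card {e \<in> E. P (norm (B *v e))}"
proof -
  have "length (filter P (singular_values B)) = size (filter_mset P (mset (singular_values B)))"
    by (simp flip: mset_filter)
  then show ?thesis
    by (simp add: mset_singular_values filter_mset_image_mset filter_mset_mset_set rsb_finite)
qed

text \<open>The nonzero images of the basis vectors are pairwise orthogonal, hence a basis of the column space.\<close>

lemma rsb_card_nonzero: "card {e \<in> E. B *v e \<noteq> 0} = rank B"
proof -
  let ?F = "{e \<in> E. B *v e \<noteq> 0}"
  have orth: "(B *v e) \<bullet> (B *v e') = 0" if "e \<in> E" "e' \<in> E" "e \<noteq> e'" for e e'
    using rsb_gram_inner[of e' e] that by (simp add: transpose_inner rsb_inner)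
  have inj: "inj_on ((*v) B) ?F"
  proof (rule inj_onI)
    fix e e' assume "e \<in> ?F" "e' \<in> ?F" "B *v e = B *v e'"
    then show "e = e'" using orth[of e e'] by auto
  qed
  have "independent ((*v) B ` ?F)"
    by (intro pairwise_orthogonal_independent) (auto simp: pairwise_def orthogonal_def intro!: orth)
  moreover have "range ((*v) B) = span ((*v) B ` ?F)"
  proof
    show "range ((*v) B) \<subseteq> span ((*v) B ` ?F)"
    proof safe
      fix u
      have "B *v u = B *v (\<Sum>e\<in>E. (u \<bullet> e) *\<^sub>R e)" by (simp add: rsb_expand)
      also have "\<dots> = (\<Sum>e\<in>E. (u \<bullet> e) *\<^sub>R (B *v e))"
        by (simp add: linear_sum[OF matrix_vector_mul_linear] linear_scale[OF matrix_vector_mul_linear])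
      also have "\<dots> = (\<Sum>e\<in>?F. (u \<bullet> e) *\<^sub>R (B *v e))"
        using rsb_finite by (intro sum.mono_neutral_right) auto
      also have "\<dots> \<in> span ((*v) B ` ?F)" by (intro span_sum span_scale span_base) auto
      finally show "B *v u \<in> span ((*v) B ` ?F)" .
    qed
    show "span ((*v) B ` ?F) \<subseteq> range ((*v) B)"
      by (intro span_minimal linear_subspace_image) auto
  qed
  ultimately show ?thesis
    using card_image[OF inj] by (simp add: rank_dim_range dim_eq_card_independent)
qed

end

lemma singular_values_decreasing:
  assumes "i \<le> j" "j < length (singular_values B)"
  shows "singular_values B ! j \<le> singular_values B ! i"
proof -
  define xs where "xs = rev (singular_values B)"
  have "sorted xs" by (simp add: xs_def singular_values_def)
  moreover have "singular_values B = rev xs" by (simp add: xs_def)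
  ultimately show ?thesis
    using assms by (simp add: rev_nth sorted_iff_nth_mono)
qed

text \<open>In a decreasing list, the entries with an upward closed property form an initial segment; so if there are
at least \<open>s\<close> of them, entry number \<open>s\<close> is among them.\<close>

lemma sing_val_upward:
  assumes up: "\<And>t t'. P t \<Longrightarrow> t \<le> t' \<Longrightarrow> P t'"
    and s: "1 \<le> s" "s \<le> length (filter P (singular_values B))"
  shows "P (sing_val s B)"
proof (rule classical)
  let ?L = "singular_values B"
  assume not: "\<not> P (sing_val s B)"
  have "{i. i < length ?L \<and> P (?L ! i)} \<subseteq> {..<s - 1}"
  proof safe
    fix i assume i: "i < length ?L" "P (?L ! i)"
    show "i < s - 1"
    proof (rule ccontr)
      assume "\<not> i < s - 1"
      then have "?L ! i \<le> sing_val s B"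
        unfolding sing_val_def using i by (intro singular_values_decreasing) auto
      then show False using up[OF i(2)] not by blast
    qed
  qed
  then have "length (filter P ?L) \<le> s - 1"
    unfolding length_filter_conv_card using card_mono[of "{..<s - 1}"] by fastforce
  then show ?thesis using s by simp
qed

lemma sing_val_le_nonzero:
  assumes s: "length (filter (\<lambda>t. 0 < t) (singular_values B)) = s"
    and t: "t \<in> set (singular_values B)" "0 < t"
  shows "sing_val s B \<le> t"
proof -
  let ?L = "singular_values B"
  obtain i where i: "i < length ?L" "t = ?L ! i" using t by (auto simp: in_set_conv_nth)
  have "{..i} \<subseteq> {j. j < length ?L \<and> 0 < ?L ! j}"
  proof
    fix j assume "j \<in> {..i}"
    then show "j \<in> {j. j < length ?L \<and> 0 < ?L ! j}"
      using singular_values_decreasing[of j i B] i t by auto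
  qed
  then have "card {..i} \<le> s"
    unfolding s[symmetric] length_filter_conv_card by (intro card_mono) auto
  moreover have "s \<le> length ?L" using s length_filter_le by metis
  ultimately show ?thesis
    unfolding sing_val_def i(2) by (intro singular_values_decreasing) auto
qed

text \<open>One half of the Courant-Fischer principle. On the span \<open>F\<close> of the right singular vectors with singular value
below \<open>\<tau>\<close> the matrix stretches nonzero vectors by less than \<open>\<tau>\<close>, so that span meets \<open>V\<close> only in \<open>0\<close>, and at least
\<open>dim V\<close> singular values are left that are \<open>\<ge> \<tau>\<close>. The hypothesis is stable under small perturbations of \<open>B\<close>, which
gives lower semicontinuity of the singular values.\<close>

lemma sing_val_ge_of_subspace:
  fixes B :: "real^'p^'n"
  assumes V: "subspace V" "s \<le> dim V" and s: "1 \<le> s"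
    and bound: "\<And>u. u \<in> V \<Longrightarrow> \<tau> * norm u \<le> norm (B *v u)" and "0 \<le> \<tau>"
  shows "\<tau> \<le> sing_val s B"
proof -
  obtain E where E: "right_singular_basis B E" using right_singular_basis_exists by blast
  define F where "F = {e \<in> E. norm (B *v e) < \<tau>}"
  have FE: "F \<subseteq> E" by (auto simp: F_def)
  have "V \<inter> span F \<subseteq> {0}"
  proof
    fix u assume u: "u \<in> V \<inter> span F"
    show "u \<in> {0}"
    proof (rule ccontr)
      assume "u \<notin> {0}"
      have out: "\<forall>e\<in>E-F. u \<bullet> e = 0" using u rsb_mem_span_iff[OF E FE] by blast
      have "\<exists>e\<in>E. u \<bullet> e \<noteq> 0"
        using \<open>u \<notin> {0}\<close> rsb_parseval[OF E, of u] by (metis (no_types, lifting) insertI1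
            norm_eq_zero sum.neutral zero_power2 power2_eq_iff_nonneg norm_ge_zero order_refl)
      then obtain e where e: "e \<in> E" "u \<bullet> e \<noteq> 0" by blast
      have "(norm (B *v u))\<^sup>2 < (\<Sum>e\<in>E. (u \<bullet> e)\<^sup>2 * \<tau>\<^sup>2)"
        unfolding rsb_norm_image[OF E, of u]
      proof (rule sum_strict_mono_ex1[OF rsb_finite[OF E]])
        show "\<forall>e\<in>E. (u \<bullet> e)\<^sup>2 * (norm (B *v e))\<^sup>2 \<le> (u \<bullet> e)\<^sup>2 * \<tau>\<^sup>2"
        proof
          fix e assume "e \<in> E"
          show "(u \<bullet> e)\<^sup>2 * (norm (B *v e))\<^sup>2 \<le> (u \<bullet> e)\<^sup>2 * \<tau>\<^sup>2"
          proof (cases "e \<in> F")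
            case True
            then have "(norm (B *v e))\<^sup>2 \<le> \<tau>\<^sup>2" by (intro power_mono) (auto simp: F_def)
            then show ?thesis by (rule mult_left_mono) simp
          next
            case False
            then show ?thesis using out \<open>e \<in> E\<close> by simp
          qed
        qed
        have "e \<in> F" using e out by auto
        then show "\<exists>a\<in>E. (u \<bullet> a)\<^sup>2 * (norm (B *v a))\<^sup>2 < (u \<bullet> a)\<^sup>2 * \<tau>\<^sup>2"
          using e by (intro bexI[of _ e] mult_strict_left_mono power_strict_mono) (auto simp: F_def)
      qed
      also have "\<dots> = (\<tau> * norm u)\<^sup>2"
        by (simp add: power_mult_distrib rsb_parseval[OF E, of u] sum_distrib_left mult.commute)
      finally have "norm (B *v u) < \<tau> * norm u"
        using \<open>0 \<le> \<tau>\<close> by (simp add: power2_less_imp_less)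
      then show False using bound u by fastforce
    qed
  qed
  then have int: "dim (V \<inter> span F) = 0" by (simp add: dim_eq_0)
  have "dim V + dim (span F) \<le> CARD('p)"
    using dim_sums_Int[OF V(1) subspace_span[of F]] dim_subset_UNIV_cart[of "{x + y |x y. x \<in> V \<and> y \<in> span F}"] int
    by linarith
  then have "s + card F \<le> card E"
    using V(2) rsb_dim[OF E FE] rsb_card[OF E] by simp
  moreover have "card E = card F + card {e \<in> E. \<tau> \<le> norm (B *v e)}"
    unfolding F_def using rsb_finite[OF E]
    by (subst card_Un_disjoint[symmetric]) (auto intro!: arg_cong[where f=card])
  ultimately have "s \<le> length (filter (\<lambda>t. \<tau> \<le> t) (singular_values B))"
    by (simp add: card_singular_values[OF E])
  then show ?thesis using sing_val_upward[of "\<lambda>t. \<tau> \<le> t" s B] s by auto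
qed

context
  fixes B :: "real^'p^'n" and s :: nat
  assumes rk: "rank B = s" and s: "1 \<le> s"
begin

lemma count_positive_singular_values: "length (filter (\<lambda>t. 0 < t) (singular_values B)) = s"
proof -
  obtain E where E: "right_singular_basis B E" using right_singular_basis_exists by blast
  then show ?thesis
    using rsb_card_nonzero[OF E] rk by (simp add: card_singular_values[OF E])
qed

lemma sing_val_rank_pos: "0 < sing_val s B"
  using sing_val_upward[of "\<lambda>t. 0 < t" s B] s count_positive_singular_values by auto

lemma sing_val_rank_le:
  assumes E: "right_singular_basis B E" and e: "e \<in> E" "B *v e \<noteq> 0"
  shows "sing_val s B \<le> norm (B *v e)"
proof (rule sing_val_le_nonzero[OF count_positive_singular_values])
  have "norm (B *v e) \<in># mset (singular_values B)"
    using e rsb_finite[OF E] by (simp add: mset_singular_values[OF E])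
  then show "norm (B *v e) \<in> set (singular_values B)" by simp
qed (use e in simp)

text \<open>For a matrix of rank \<open>s\<close>, the \<open>s\<close>-th singular value is the smallest nonzero one. Writing \<open>v = B *v u\<close>, the
components of \<open>u\<close> are multiplied by \<open>norm (B *v e)\<close> in the norm of \<open>v\<close> and by its square in the norm of
\<open>transpose B *v v\<close>.\<close>

lemma sing_val_rank_range:
  assumes "v \<in> range ((*v) B)"
  shows "sing_val s B * norm v \<le> norm (transpose B *v v)"
proof -
  obtain u where u: "v = B *v u" using assms by blast
  obtain E where E: "right_singular_basis B E" using right_singular_basis_exists by blast
  have "(sing_val s B * norm v)\<^sup>2 = (\<Sum>e\<in>E. (sing_val s B)\<^sup>2 * ((u \<bullet> e)\<^sup>2 * (norm (B *v e))\<^sup>2))"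
    by (simp add: u power_mult_distrib rsb_norm_image[OF E, of u] sum_distrib_left)
  also have "\<dots> \<le> (\<Sum>e\<in>E. ((u \<bullet> e) * (norm (B *v e))\<^sup>2)\<^sup>2)"
  proof (rule sum_mono)
    fix e assume e: "e \<in> E"
    show "(sing_val s B)\<^sup>2 * ((u \<bullet> e)\<^sup>2 * (norm (B *v e))\<^sup>2) \<le> ((u \<bullet> e) * (norm (B *v e))\<^sup>2)\<^sup>2"
    proof (cases "B *v e = 0")
      case False
      have "(sing_val s B)\<^sup>2 \<le> (norm (B *v e))\<^sup>2"
        using sing_val_rank_le[OF E e False] sing_val_rank_pos by (intro power_mono) auto
      then have "(sing_val s B)\<^sup>2 * ((u \<bullet> e)\<^sup>2 * (norm (B *v e))\<^sup>2)
          \<le> (norm (B *v e))\<^sup>2 * ((u \<bullet> e)\<^sup>2 * (norm (B *v e))\<^sup>2)"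
        by (intro mult_right_mono) auto
      then show ?thesis by (simp add: power_mult_distrib power2_eq_square mult_ac)
    qed simp
  qed
  also have "\<dots> = (norm (transpose B *v v))\<^sup>2"
    by (simp add: u rsb_gram[OF E] rsb_norm_sum[OF E])
  finally show ?thesis by (rule power2_le_imp_le) simp
qed

text \<open>The witness for which \<open>sing_val_ge_of_subspace\<close> is sharp: the span of the right singular vectors that are
not in the kernel.\<close>

lemma sing_val_rank_subspace:
  obtains V where "subspace V" "dim V = s" "\<And>u. u \<in> V \<Longrightarrow> sing_val s B * norm u \<le> norm (B *v u)"
proof -
  obtain E where E: "right_singular_basis B E" using right_singular_basis_exists by blast
  define F where "F = {e \<in> E. B *v e \<noteq> 0}"
  have FE: "F \<subseteq> E" by (auto simp: F_def)
  have "sing_val s B * norm u \<le> norm (B *v u)" if u: "u \<in> span F" for u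
  proof -
    have "(sing_val s B * norm u)\<^sup>2 = (\<Sum>e\<in>E. (sing_val s B)\<^sup>2 * (u \<bullet> e)\<^sup>2)"
      by (simp add: power_mult_distrib rsb_parseval[OF E, of u] sum_distrib_left)
    also have "\<dots> \<le> (\<Sum>e\<in>E. (u \<bullet> e)\<^sup>2 * (norm (B *v e))\<^sup>2)"
    proof (rule sum_mono)
      fix e assume e: "e \<in> E"
      show "(sing_val s B)\<^sup>2 * (u \<bullet> e)\<^sup>2 \<le> (u \<bullet> e)\<^sup>2 * (norm (B *v e))\<^sup>2"
      proof (cases "e \<in> F")
        case True
        then have "(sing_val s B)\<^sup>2 \<le> (norm (B *v e))\<^sup>2"
          using sing_val_rank_le[OF E e] sing_val_rank_pos by (intro power_mono) (auto simp: F_def)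
        then show ?thesis by (subst mult.commute) (rule mult_left_mono, auto)
      next
        case False
        then show ?thesis using u e rsb_mem_span_iff[OF E FE] by auto
      qed
    qed
    also have "\<dots> = (norm (B *v u))\<^sup>2" by (simp add: rsb_norm_image[OF E, of u])
    finally show ?thesis by (rule power2_le_imp_le) simp
  qed
  moreover have "dim (span F) = s"
    using rsb_dim[OF E FE] rsb_card_nonzero[OF E] rk by (simp add: F_def)
  ultimately show thesis using that[of "span F"] by simp
qed

end

section \<open>Derivatives in terms of the transposed Jacobian\<close>

lemma has_derivative_tjac:
  fixes F :: "real^'n \<Rightarrow> real^'m"
  assumes "F differentiable (at x)"
  shows "(F has_derivative (\<lambda>h. transpose (tjac F x) *v h)) (at x)"
  using assms by (simp add: tjac_def jacobian_works)

lemma has_derivative_grad: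
  fixes f :: "real^'n \<Rightarrow> real"
  assumes "f differentiable (at x)"
  shows "(f has_derivative (\<lambda>h. grad f x \<bullet> h)) (at x)"
proof -
  have D: "(f has_derivative frechet_derivative f (at x)) (at x)"
    using assms by (simp add: frechet_derivative_works)
  interpret linear "frechet_derivative f (at x)"
    using D has_derivative_linear by blast
  have "frechet_derivative f (at x) h = grad f x \<bullet> h" for h
  proof -
    have "frechet_derivative f (at x) h = frechet_derivative f (at x) (\<Sum>i\<in>UNIV. (h $ i) *\<^sub>R axis i 1)"
      by (simp add: basis_expansion flip: scalar_mult_eq_scaleR)
    also have "\<dots> = grad f x \<bullet> h"
      by (simp add: sum scale grad_def inner_vec_def mult.commute)
    finally show ?thesis .
  qed
  then show ?thesis using D by presburger
qed

lemma grad_unique: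
  fixes f :: "real^'n \<Rightarrow> real"
  assumes "(f has_derivative (\<lambda>h. g \<bullet> h)) (at x)"
  shows "grad f x = g"
  unfolding grad_def frechet_derivative_at[OF assms, symmetric] by (simp add: vec_eq_iff inner_axis)

lemma grad_component:
  fixes c :: "real^'n \<Rightarrow> real^'p"
  assumes "c differentiable (at x)"
  shows "grad (\<lambda>z. c z $ i) x = column i (tjac c x)"
proof (rule grad_unique)
  have "((\<lambda>z. c z $ i) has_derivative (\<lambda>h. (transpose (tjac c x) *v h) $ i)) (at x)"
    by (intro bounded_linear.has_derivative[OF bounded_linear_vec_nth] has_derivative_tjac assms)
  moreover have "(transpose (tjac c x) *v h) $ i = column i (tjac c x) \<bullet> h" for h
    by (simp add: matrix_vector_mul_component row_def flip: row_transpose)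
  ultimately show "((\<lambda>z. c z $ i) has_derivative (\<bullet>) (column i (tjac c x))) (at x)"
    by simp
qed

lemma grad_constraint_dissolving:
  fixes f :: "real^'n \<Rightarrow> real" and c :: "real^'n \<Rightarrow> real^'p" and A :: "real^'n \<Rightarrow> real^'n"
  assumes "f differentiable (at (A y))" "c differentiable (at y)" "A differentiable (at y)"
  shows "grad (constraint_dissolving f c A \<beta>) y
    = tjac A y *v grad f (A y) + \<beta> *\<^sub>R (tjac c y *v c y)"
proof (rule grad_unique)
  note dA = has_derivative_tjac[OF assms(3)] and dc = has_derivative_tjac[OF assms(2)]
  have "((\<lambda>y. f (A y)) has_derivative (\<lambda>h. grad f (A y) \<bullet> (transpose (tjac A y) *v h))) (at y)"
    using has_derivative_compose[OF dA has_derivative_grad[OF assms(1)]] .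
  moreover have "((\<lambda>y. \<beta> / 2 * (c y \<bullet> c y)) has_derivative
      (\<lambda>h. \<beta> / 2 * (c y \<bullet> (transpose (tjac c y) *v h) + (transpose (tjac c y) *v h) \<bullet> c y))) (at y)"
    by (intro derivative_intros dc)
  ultimately have "((\<lambda>y. f (A y) + \<beta> / 2 * (c y \<bullet> c y)) has_derivative
     (\<lambda>h. grad f (A y) \<bullet> (transpose (tjac A y) *v h) +
        \<beta> / 2 * (c y \<bullet> (transpose (tjac c y) *v h) + (transpose (tjac c y) *v h) \<bullet> c y))) (at y)"
    by (rule has_derivative_add)
  moreover have "grad f (A y) \<bullet> (transpose (tjac A y) *v h) +
        \<beta> / 2 * (c y \<bullet> (transpose (tjac c y) *v h) + (transpose (tjac c y) *v h) \<bullet> c y)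
      = (tjac A y *v grad f (A y) + \<beta> *\<^sub>R (tjac c y *v c y)) \<bullet> h" for h
    using transpose_inner[of "tjac A y" h "grad f (A y)"] transpose_inner[of "tjac c y" h "c y"]
    by (simp add: inner_add_right inner_commute)
  ultimately show "(constraint_dissolving f c A \<beta> has_derivative
      (\<bullet>) (tjac A y *v grad f (A y) + \<beta> *\<^sub>R (tjac c y *v c y))) (at y)"
    by (simp add: constraint_dissolving_def[abs_def] dot_square_norm)
qed

text \<open>The column space is the orthogonal complement of the kernel of the transpose. This is how both the
Lagrange multiplier and the normal direction at a nearest feasible point are produced.\<close>

lemma orthogonal_kernel_transpose:
  fixes B :: "real^'p^'n"
  assumes "\<And>v. transpose B *v v = 0 \<Longrightarrow> g \<bullet> v = 0"
  shows "g \<in> range ((*v) B)"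
proof -
  let ?R = "range ((*v) B)"
  have R: "subspace ?R" by (intro linear_subspace_image) auto
  obtain r k where rk: "r \<in> span ?R" "\<And>w. w \<in> span ?R \<Longrightarrow> orthogonal k w" "g = r + k"
    using orthogonal_subspace_decomp_exists[of ?R g] by metis
  have "(transpose B *v k) \<bullet> u = 0" for u
    using rk(2)[of "B *v u"] by (simp add: transpose_inner orthogonal_def span_base)
  then have "transpose B *v k = 0"
    using inner_eq_zero_iff by blast
  then have "g \<bullet> k = 0" by (rule assms)
  moreover have "r \<bullet> k = 0" using rk(1,2) by (metis orthogonal_def inner_commute)
  ultimately have "k = 0" using rk(3) by (simp add: inner_add_left)
  then show ?thesis using rk(1,3) R by (simp add: span_eq_iff[THEN iffD2])
qed

section \<open>Tangent vectors of a constant-rank level set\<close>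

text \<open>The row space of \<open>P ** Q\<close> lies in that of \<open>Q\<close>; if the ranks agree the row spaces coincide, and so do
their orthogonal complements, the kernels.\<close>

lemma kernel_eq_of_rank_mult:
  fixes P :: "real^'m^'k" and Q :: "real^'n^'m"
  assumes "rank Q \<le> rank (P ** Q)" and "P *v (Q *v u) = 0"
  shows "Q *v u = 0"
proof -
  have sub: "span (rows (P ** Q)) \<subseteq> span (rows Q)"
  proof (rule span_minimal)
    show "rows (P ** Q) \<subseteq> span (rows Q)"
    proof
      fix r assume "r \<in> rows (P ** Q)"
      then obtain i where "r = row i (P ** Q)" by (auto simp: rows_def)
      then have "r = transpose Q *v row i P"
        by (metis column_transpose matrix_transpose_mul matrix_vector_mul_assoc matrix_vector_mult_basis)
      then show "r \<in> span (rows Q)"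
        using matrix_vector_mult_in_columnspace[of "transpose Q" "row i P"] by simp
    qed
  qed simp
  have eq: "span (rows (P ** Q)) = span (rows Q)"
    using assms(1) by (intro subspace_dim_equal sub) (auto simp: row_rank_def)
  have "(Q *v u) $ i = 0" for i
  proof -
    have "row i Q \<in> span (rows (P ** Q))"
      unfolding eq by (intro span_base) (auto simp: rows_def)
    then have "orthogonal u (row i Q)"
      using assms(2) orthogonal_nullspace_rowspace by (metis matrix_vector_mul_assoc)
    then show ?thesis
      by (simp add: matrix_vector_mul_component orthogonal_def inner_commute row_def)
  qed
  then show ?thesis by (simp add: vec_eq_iff)
qed

lemma orthogonal_projection_exists:
  fixes K :: "'a::euclidean_space set"
  assumes "subspace K"
  obtains P where "linear P" "\<And>u. P u \<in> K" "\<And>u. u \<in> K \<Longrightarrow> P u = u"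
    "\<And>u. (\<And>k. k \<in> K \<Longrightarrow> u \<bullet> k = 0) \<Longrightarrow> P u = 0"
proof -
  obtain E where E: "E \<subseteq> K" "pairwise orthogonal E" "\<And>x. x \<in> E \<Longrightarrow> norm x = 1"
    "independent E" "span E = K"
    using orthonormal_basis_subspace[OF assms] by metis
  have fin: "finite E" using E(4) by (rule independent_imp_finite)
  define P where "P u = (\<Sum>e\<in>E. (u \<bullet> e) *\<^sub>R e)" for u
  show thesis
  proof
    show "linear P"
      unfolding P_def by (intro linear_compose_sum ballI linearI) (auto simp: inner_add_left scaleR_add_left)
    show "P u \<in> K" for u
      unfolding P_def E(5)[symmetric] by (intro span_sum span_scale span_base)
    show "P u = u" if "u \<in> K" for u
      unfolding P_def using E fin that by (intro orthonormal_basis_expand) auto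
    show "P u = 0" if "\<And>k. k \<in> K \<Longrightarrow> u \<bullet> k = 0" for u
      unfolding P_def using that E(1) by (intro sum.neutral) auto
  qed
qed

text \<open>Every vector \<open>v\<close> of the linearised level set is the velocity of a curve in the level set. With \<open>J = tjac c z\<close>
and \<open>P\<close> the orthogonal projection onto the kernel \<open>K\<close> of \<open>transpose J\<close>, the map
\<open>\<Phi> w = J *v c w + P (w - z)\<close> has an invertible derivative at \<open>z\<close>, because its two summands take values in
complementary subspaces and the kernels of their derivatives meet only in \<open>0\<close>. Let \<open>g\<close> be the local inverse and
\<open>\<gamma> t = g (t v)\<close>. Then \<open>J *v c (\<gamma> t) = 0\<close> by construction, which by itself controls only one linear image of
\<open>c (\<gamma> t)\<close>. Constant rank closes the gap: at every \<open>w\<close> near \<open>z\<close> the product of \<open>J\<close> with \<open>transpose (tjac c w)\<close> still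
has rank at least \<open>rank J\<close>, which is the rank of the second factor, so both have the same kernel; hence
\<open>c (\<gamma> t)\<close> has derivative \<open>0\<close> and stays at \<open>c z = 0\<close>.\<close>

lemma constant_rank_tangent_curve:
  fixes c :: "real^'n \<Rightarrow> real^'p" and z v :: "real^'n"
  assumes diff: "\<And>w. c differentiable (at w)" and cont: "continuous_on UNIV (tjac c)"
    and X: "z \<in> interior X" and rk: "\<And>w. w \<in> X \<Longrightarrow> rank (tjac c w) = r"
    and z: "c z = 0" and v: "transpose (tjac c z) *v v = 0"
  obtains \<gamma> where "\<gamma> 0 = z" "(\<gamma> has_vector_derivative v) (at 0)"
    "eventually (\<lambda>t. c (\<gamma> t) = 0) (at 0)"
proof -
  define J where "J = tjac c z"
  define K where "K = {u. transpose J *v u = 0}"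
  have K: "subspace K"
    unfolding K_def by (auto simp: subspace_def matrix_vector_right_distrib matrix_vector_mult_scaleR)
  obtain P where P: "linear P" "\<And>u. P u \<in> K" "\<And>u. u \<in> K \<Longrightarrow> P u = u"
    "\<And>u. (\<And>k. k \<in> K \<Longrightarrow> u \<bullet> k = 0) \<Longrightarrow> P u = 0"
    using orthogonal_projection_exists[OF K] by metis
  have PJ: "P (J *v a) = 0" for a
  proof (rule P(4))
    fix k assume "k \<in> K"
    then show "(J *v a) \<bullet> k = 0" using transpose_inner[of J k a] by (simp add: K_def inner_commute)
  qed
  define \<Phi> where "\<Phi> w = J *v c w + P (w - z)" for w
  define D where "D w u = J *v (transpose (tjac c w) *v u) + P u" for w u
  \<comment> \<open>The two summands of \<open>\<Phi>\<close> can be separated again by applying \<open>P\<close>.\<close>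
  have PD: "P (D w u) = P u" for w u
    using P(1) by (simp add: D_def linear_add PJ P(2,3))
  have linD: "linear (D w)" for w
    unfolding D_def[abs_def]
    by (intro linear_compose_add P(1) linear_compose[of "(*v) (transpose (tjac c w))" "(*v) J", unfolded o_def]) auto
  have bD: "bounded_linear (D w)" for w
    using linD by (simp add: linear_conv_bounded_linear)
  have derP: "(P has_derivative P) F" for F
    using P(1) by (intro bounded_linear_imp_has_derivative) (simp add: linear_conv_bounded_linear)
  have der: "(\<Phi> has_derivative D w) (at w)" for w
  proof -
    have "((\<lambda>w. J *v c w) has_derivative (\<lambda>u. J *v (transpose (tjac c w) *v u))) (at w)"
      by (intro bounded_linear.has_derivative[OF matrix_vector_mul_bounded_linear] has_derivative_tjac diff)
    moreover have "((\<lambda>w. P (w - z)) has_derivative P) (at w)"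
    proof -
      have "((\<lambda>w. w - z) has_derivative (\<lambda>u. u)) (at w)" by (auto intro!: derivative_eq_intros)
      then show ?thesis by (rule has_derivative_compose) (rule derP)
    qed
    ultimately show ?thesis unfolding \<Phi>_def[abs_def] D_def[abs_def] by (rule has_derivative_add)
  qed
  define D' where "D' w = Blinfun (D w)" for w
  have D': "blinfun_apply (D' w) = D w" for w
    unfolding D'_def using bD by (rule bounded_linear_Blinfun_apply)
  have contD': "continuous_on (interior X) D'"
  proof (rule continuous_on_blinfun_componentwise)
    fix i :: "real^'n"
    have "continuous_on (interior X) (\<lambda>w. transpose (tjac c w) *v i)"
    proof -
      have "linear (\<lambda>M::real^'p^'n. transpose M *v i)"
        by (intro linearI)
           (auto simp: vec_eq_iff matrix_vector_mult_def transpose_def sum.distrib distrib_right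
             sum_distrib_left mult.assoc)
      with continuous_on_subset[OF cont subset_UNIV] show ?thesis
        by (rule linear_continuous_on_compose)
    qed
    then show "continuous_on (interior X) (\<lambda>w. blinfun_apply (D' w) i)"
      unfolding D' D_def
      by (intro continuous_intros linear_continuous_on_compose[OF _ matrix_vector_mul_linear])
  qed
  have "D z u = 0 \<Longrightarrow> u = 0" for u
  proof -
    assume D0: "D z u = 0"
    then have "P u = 0" using PD[of z u] P(1) by (simp add: linear_0)
    then have "J *v (transpose J *v u) = 0" using D0 by (simp add: D_def J_def)
    then have "(transpose J *v u) \<bullet> (transpose J *v u) = 0"
      by (simp add: transpose_inner)
    then have "u \<in> K" by (simp add: K_def)
    then show "u = 0" using P(3) \<open>P u = 0\<close> by simp
  qed
  then have "inj (D z)" using linD by (simp add: linear_injective_0)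
  then obtain I where I: "linear I" "\<And>u. I (D z u) = u"
    using linear_injective_left_inverse[OF linD] by (metis comp_apply id_apply)
  have inv: "Blinfun I o\<^sub>L D' z = id_blinfun"
    using I by (intro blinfun_eqI) (simp add: D' bounded_linear_Blinfun_apply linear_conv_bounded_linear)
  obtain U V g g' where U: "open U" "U \<subseteq> interior X" "z \<in> U" "open V" "\<Phi> z \<in> V"
    and hom: "homeomorphism U V \<Phi> g"
    and dg: "\<And>y. y \<in> V \<Longrightarrow> (g has_derivative (g' y)) (at y)"
    and g': "\<And>y. y \<in> V \<Longrightarrow> g' y = inv (blinfun_apply (D' (g y)))"
    and bij: "\<And>y. y \<in> V \<Longrightarrow> bij (blinfun_apply (D' (g y)))"
    using inverse_function_theorem[of "interior X" \<Phi> D' z "Blinfun I", OF _ _ contD' X inv] der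
    unfolding D' by (metis open_interior)
  have \<Phi>z: "\<Phi> z = 0" using P(1) z by (simp add: \<Phi>_def linear_0)
  have g: "g y \<in> U" "\<Phi> (g y) = y" if "y \<in> V" for y
    using hom that unfolding homeomorphism_def by auto
  have g0: "g 0 = z" using hom U(3) \<Phi>z unfolding homeomorphism_def by metis
  define \<gamma> where "\<gamma> t = g (t *\<^sub>R v)" for t :: real
  obtain \<delta> where \<delta>: "\<delta> > 0" "ball 0 \<delta> \<subseteq> V"
    using U(4,5) \<Phi>z open_contains_ball by metis
  define e where "e = \<delta> / (norm v + 1)"
  have e: "e > 0" using \<delta> by (simp add: e_def add_nonneg_pos)
  have tV: "t *\<^sub>R v \<in> V" if "\<bar>t\<bar> < e" for t
  proof -
    have "\<bar>t\<bar> * norm v \<le> \<bar>t\<bar> * (norm v + 1)" by (simp add: mult_left_mono)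
    also have "\<dots> < \<delta>" using that by (simp add: e_def pos_less_divide_eq add_nonneg_pos)
    finally show ?thesis using \<delta> by (auto simp: subset_iff)
  qed
  have vK: "v \<in> K" using v by (simp add: K_def J_def)
  have D\<gamma>: "D (\<gamma> t) (g' (t *\<^sub>R v) v) = v" if "\<bar>t\<bar> < e" for t
    using g'[OF tV[OF that]] bij[OF tV[OF that]]
    by (simp add: D' \<gamma>_def bij_is_surj surj_f_inv_f)
  have d\<gamma>: "(\<gamma> has_vector_derivative g' (t *\<^sub>R v) v) (at t)" if "\<bar>t\<bar> < e" for t
  proof -
    have "((\<lambda>t. t *\<^sub>R v) has_derivative (\<lambda>s. s *\<^sub>R v)) (at t)"
      by (auto intro!: derivative_eq_intros)
    from has_derivative_compose[OF this dg[OF tV[OF that]]]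
    have "(\<gamma> has_derivative (\<lambda>s. g' (t *\<^sub>R v) (s *\<^sub>R v))) (at t)"
      unfolding \<gamma>_def .
    moreover have "g' (t *\<^sub>R v) (s *\<^sub>R v) = s *\<^sub>R g' (t *\<^sub>R v) v" for s
      using has_derivative_linear[OF dg[OF tV[OF that]]] by (rule linear_scale)
    ultimately show ?thesis by (simp add: has_vector_derivative_def)
  qed
  have dc: "((\<lambda>t. c (\<gamma> t)) has_derivative (\<lambda>_. 0)) (at t)" if "\<bar>t\<bar> < e" for t
  proof -
    let ?w = "\<gamma> t" and ?u = "g' (t *\<^sub>R v) v"
    have w: "?w \<in> X" "?w \<in> U" using g(1)[OF tV[OF that]] U(2) interior_subset by (auto simp: \<gamma>_def)
    have surj: "surj (D ?w)" using bij[OF tV[OF that]] by (simp add: D' \<gamma>_def bij_is_surj)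
    \<comment> \<open>Since \<open>D ?w\<close> is onto, its component in the column space of \<open>J\<close> fills that whole space.\<close>
    have "range ((*v) J) \<subseteq> range ((*v) (J ** transpose (tjac c ?w)))"
    proof safe
      fix a
      obtain u where u: "J *v a = D ?w u" using surj by (metis surjD)
      have "P u = 0" using PD[of ?w u] PJ u by metis
      then have "J *v a = J *v (transpose (tjac c ?w) *v u)" using u by (simp add: D_def)
      then show "J *v a \<in> range ((*v) (J ** transpose (tjac c ?w)))"
        by (simp add: matrix_vector_mul_assoc)
    qed
    then have "rank J \<le> rank (J ** transpose (tjac c ?w))"
      unfolding rank_dim_range by (rule dim_subset)
    moreover have "rank J = rank (transpose (tjac c ?w))"
      using rk w(1) X interior_subset unfolding J_def rank_transpose by (metis subsetD)
    moreover have "J *v (transpose (tjac c ?w) *v ?u) = 0"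
    proof -
      have "P ?u = v" using PD[of ?w ?u] D\<gamma>[OF that] P(3) vK by simp
      then show ?thesis using D\<gamma>[OF that] by (simp add: D_def)
    qed
    ultimately have "transpose (tjac c ?w) *v ?u = 0"
      by (intro kernel_eq_of_rank_mult[of _ J]) simp_all
    moreover have "((\<lambda>t. c (\<gamma> t)) has_derivative (\<lambda>s. transpose (tjac c ?w) *v (s *\<^sub>R ?u))) (at t)"
      using has_derivative_compose[OF d\<gamma>[OF that, unfolded has_vector_derivative_def] has_derivative_tjac[OF diff]] .
    ultimately show ?thesis by (simp add: matrix_vector_mult_scaleR)
  qed
  have const: "c (\<gamma> t) = 0" if "\<bar>t\<bar> < e" for t
  proof -
    have "c (\<gamma> t) = c (\<gamma> 0)"
    proof (rule has_derivative_zero_unique[where f="\<lambda>t. c (\<gamma> t)" and s="ball 0 e"])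
      show "((\<lambda>t. c (\<gamma> t)) has_derivative (\<lambda>h. 0)) (at s within ball 0 e)" if "s \<in> ball 0 e" for s
        using dc[of s] that by (auto intro: has_derivative_at_withinI)
    qed (use that e in auto)
    then show ?thesis using g0 z by (simp add: \<gamma>_def)
  qed
  show thesis
  proof (rule that[of \<gamma>])
    show "\<gamma> 0 = z" using g0 by (simp add: \<gamma>_def)
    have "D z (g' 0 v) = v" using D\<gamma>[of 0] e g0 by (simp add: \<gamma>_def)
    moreover have "D z v = v" using vK P(3) by (simp add: D_def K_def J_def)
    ultimately have "g' 0 v = v" using \<open>inj (D z)\<close> by (metis injD)
    then show "(\<gamma> has_vector_derivative v) (at 0)" using d\<gamma>[of 0] e by simp
    show "eventually (\<lambda>t. c (\<gamma> t) = 0) (at 0)"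
      using const e unfolding eventually_at by (auto simp: dist_real_def)
  qed
qed

text \<open>A map that fixes the level set pointwise fixes the curve with velocity \<open>v\<close>, and therefore its derivative
fixes \<open>v\<close>.\<close>

lemma tangent_fixed:
  fixes c :: "real^'n \<Rightarrow> real^'p" and A :: "real^'n \<Rightarrow> real^'n"
  assumes diff: "\<And>w. c differentiable (at w)" and cont: "continuous_on UNIV (tjac c)"
    and X: "z \<in> interior X" and rk: "\<And>w. w \<in> X \<Longrightarrow> rank (tjac c w) = r"
    and z: "c z = 0" and v: "transpose (tjac c z) *v v = 0"
    and A: "A differentiable (at z)" "\<And>w. w \<in> feasible c \<Longrightarrow> A w = w"
  shows "transpose (tjac A z) *v v = v"
proof -
  obtain \<gamma> where \<gamma>: "\<gamma> 0 = z" "(\<gamma> has_vector_derivative v) (at 0)"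
    "eventually (\<lambda>t. c (\<gamma> t) = 0) (at 0)"
    using constant_rank_tangent_curve[OF diff cont X rk z v] by metis
  have "((\<lambda>t. A (\<gamma> t)) has_derivative (\<lambda>s. transpose (tjac A z) *v (s *\<^sub>R v))) (at 0)"
    using has_derivative_compose[OF \<gamma>(2)[unfolded has_vector_derivative_def], of A] has_derivative_tjac[OF A(1)] \<gamma>(1)
    by auto
  then have 1: "((\<lambda>t. A (\<gamma> t)) has_vector_derivative (transpose (tjac A z) *v v)) (at 0)"
    by (simp add: has_vector_derivative_def matrix_vector_mult_scaleR)
  have ev: "eventually (\<lambda>t. A (\<gamma> t) = \<gamma> t) (at 0)"
    using \<gamma>(3) by eventually_elim (simp add: A(2) feasible_def)
  have "(\<gamma> has_vector_derivative (transpose (tjac A z) *v v)) (at 0)"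
    using 1 ev A(2)[of "\<gamma> 0"] z \<gamma>(1) unfolding has_vector_derivative_def
    by (intro has_derivative_transform_eventually[where f="\<lambda>t. A (\<gamma> t)" and g=\<gamma>])
      (auto simp: feasible_def)
  then show ?thesis using \<gamma>(2) vector_derivative_unique_at by blast
qed

text \<open>Along a curve in the level set through \<open>z\<close> the squared distance to \<open>y\<close> is minimal at \<open>z\<close>, so \<open>y - z\<close> is
orthogonal to every tangent vector, that is, to the kernel of \<open>transpose (tjac c z)\<close>.\<close>

lemma nearest_point_normal:
  fixes c :: "real^'n \<Rightarrow> real^'p"
  assumes diff: "\<And>w. c differentiable (at w)" and cont: "continuous_on UNIV (tjac c)"
    and X: "z \<in> interior X" and rk: "\<And>w. w \<in> X \<Longrightarrow> rank (tjac c w) = r"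
    and z: "c z = 0" and near: "\<And>w. w \<in> feasible c \<Longrightarrow> norm (y - z) \<le> norm (y - w)"
  shows "y - z \<in> range ((*v) (tjac c z))"
proof (rule orthogonal_kernel_transpose)
  fix v assume v: "transpose (tjac c z) *v v = 0"
  obtain \<gamma> where \<gamma>: "\<gamma> 0 = z" "(\<gamma> has_vector_derivative v) (at 0)"
    "eventually (\<lambda>t. c (\<gamma> t) = 0) (at 0)"
    using constant_rank_tangent_curve[OF diff cont X rk z v] by metis
  define q where "q t = (y - \<gamma> t) \<bullet> (y - \<gamma> t)" for t
  have "(q has_derivative (\<lambda>s. (y - z) \<bullet> (0 - s *\<^sub>R v) + (0 - s *\<^sub>R v) \<bullet> (y - z))) (at 0)"
    unfolding q_def[abs_def] using \<gamma>(1,2) unfolding has_vector_derivative_def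
    by (auto intro!: derivative_eq_intros)
  then have dq: "(q has_real_derivative - 2 * ((y - z) \<bullet> v)) (at 0)"
    by (rule has_derivative_imp_has_field_derivative) (simp add: inner_commute algebra_simps)
  obtain d where d: "d > 0" "\<And>t. t \<noteq> 0 \<Longrightarrow> \<bar>t\<bar> < d \<Longrightarrow> c (\<gamma> t) = 0"
    using \<gamma>(3) unfolding eventually_at by (auto simp: dist_real_def)
  have "- 2 * ((y - z) \<bullet> v) = 0"
  proof (rule DERIV_local_min[OF dq d(1)], intro allI impI)
    fix t :: real assume "\<bar>0 - t\<bar> < d"
    then have "c (\<gamma> t) = 0" using d(2)[of t] \<gamma>(1) z by (cases "t = 0") auto
    then have "norm (y - z) \<le> norm (y - \<gamma> t)" using near by (simp add: feasible_def)
    then show "q 0 \<le> q t" using \<gamma>(1) by (simp add: q_def dot_square_norm)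
  qed
  then show "(y - z) \<bullet> v = 0" by simp
qed

section \<open>Spectral norms and Lipschitz constants\<close>

lemma norm_mult_le_spectral_norm:
  fixes B :: "real^'p^'n"
  shows "norm (B *v u) \<le> spectral_norm B * norm u"
  unfolding spectral_norm_def by (rule onorm) (rule matrix_vector_mul_bounded_linear)

lemma spectral_norm_nonneg: "0 \<le> spectral_norm (B :: real^'p^'n)"
  unfolding spectral_norm_def by (rule onorm_pos_le) (rule matrix_vector_mul_bounded_linear)

lemma norm_transpose_mult_le_spectral_norm:
  fixes B :: "real^'p^'n"
  shows "norm (transpose B *v v) \<le> spectral_norm B * norm v"
proof (cases "transpose B *v v = 0")
  case False
  let ?w = "transpose B *v v"
  have "norm ?w * norm ?w = v \<bullet> (B *v ?w)"
    by (metis transpose_inner dot_square_norm power2_eq_square)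
  also have "\<dots> \<le> norm v * norm (B *v ?w)" by (rule norm_cauchy_schwarz)
  also have "\<dots> \<le> norm v * (spectral_norm B * norm ?w)"
    by (intro mult_left_mono norm_mult_le_spectral_norm) simp
  finally have "norm ?w * norm ?w \<le> (spectral_norm B * norm v) * norm ?w" by (simp add: mult_ac)
  then show ?thesis using False by (simp add: mult_le_cancel_right)
qed (simp add: spectral_norm_nonneg)

lemma norm_transpose_mult_le:
  fixes B :: "real^'p^'n"
  assumes "spectral_norm B \<le> b" "norm v \<le> e"
  shows "norm (transpose B *v v) \<le> b * e"
proof -
  have "0 \<le> b" using assms(1) spectral_norm_nonneg[of B] by linarith
  then have "spectral_norm B * norm v \<le> b * e" using assms by (intro mult_mono) auto
  then show ?thesis using norm_transpose_mult_le_spectral_norm[of B v] by linarith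
qed

lemma spectral_norm_le_frobenius: "spectral_norm (B :: real^'p^'n) \<le> norm B"
  unfolding spectral_norm_def
proof (rule onorm_le)
  fix u :: "real^'p"
  have "norm (B *v u) \<le> L2_set (\<lambda>i. norm (B $ i) * norm u) UNIV"
    unfolding norm_vec_def[of "B *v u"]
    by (intro L2_set_mono) (auto simp: matrix_mult_dot Cauchy_Schwarz_ineq2)
  also have "\<dots> = norm B * norm u"
    unfolding norm_vec_def[of B] by (simp add: L2_set_left_distrib)
  finally show "norm (B *v u) \<le> norm B * norm u" .
qed

lemma norm_mult_le_frobenius: "norm (B *v u) \<le> norm (B :: real^'p^'n) * norm u"
  by (rule order_trans[OF norm_mult_le_spectral_norm mult_right_mono[OF spectral_norm_le_frobenius norm_ge_zero]])

lemma continuous_on_locally_lipschitz: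
  assumes "locally_lipschitz F"
  shows "continuous_on S F"
proof -
  have "isCont F x" for x
  proof -
    obtain r L where "r > 0" "L-lipschitz_on (ball x r) F"
      using assms unfolding locally_lipschitz_def by blast
    then show ?thesis
      using lipschitz_on_continuous_on continuous_on_interior[of "ball x r" F x] by auto
  qed
  then show ?thesis by (simp add: continuous_at_imp_continuous_on)
qed

lemma locally_lipschitz_compact:
  assumes F: "locally_lipschitz F" and S: "compact S"
  obtains L where "L-lipschitz_on S F"
proof -
  have ll: "local_lipschitz {0::real} S (\<lambda>_. F)"
  proof (rule local_lipschitzI)
    fix x assume "x \<in> S"
    obtain r L where "r > 0" "L-lipschitz_on (ball x r) F"
      using F unfolding locally_lipschitz_def by blast
    moreover have "cball x (r / 2) \<inter> S \<subseteq> ball x r" using \<open>r > 0\<close> by auto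
    ultimately have "L-lipschitz_on (cball x (r / 2) \<inter> S) F" by (blast intro: lipschitz_on_subset)
    then show "\<exists>u>0. \<exists>L. \<forall>t\<in>cball t u \<inter> {0::real}. L-lipschitz_on (cball x u \<inter> S) F" for t
      using \<open>r > 0\<close> by (intro exI[of _ "r/2"]) auto
  qed
  show thesis
    by (rule local_lipschitz_compact_implies_lipschitz[OF ll S]) (auto intro: that)
qed

lemma spectral_norm_le_sup_norm_on:
  assumes "continuous_on S F" "compact S" "y \<in> S"
  shows "spectral_norm (F y) \<le> sup_norm_on S F"
proof -
  have "bounded (F ` S)" using assms(1,2) compact_continuous_image compact_imp_bounded by blast
  then obtain b where "\<And>y. y \<in> S \<Longrightarrow> norm (F y) \<le> b" unfolding bounded_iff by blast
  then have "bdd_above ((\<lambda>y. spectral_norm (F y)) ` S)"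
    by (intro bdd_aboveI2[of _ _ b]) (meson order_trans spectral_norm_le_frobenius)
  then show ?thesis unfolding sup_norm_on_def using assms(3) by (intro cSUP_upper)
qed

context
  fixes F :: "real^'n \<Rightarrow> real^'q^'m" and S :: "(real^'n) set" and C :: real
  assumes C: "C-lipschitz_on S F"
begin

text \<open>A real supremum is an upper bound only for a set that is bounded above; the Lipschitz hypothesis, for the
Frobenius norm and with any constant \<open>C\<close>, provides this.\<close>

lemma difference_quotient_le_lip_const_on:
  assumes "y \<in> S" "z \<in> S" "y \<noteq> z"
  shows "spectral_norm (F y - F z) / norm (y - z) \<le> lip_const_on S F"
proof -
  have "spectral_norm (F y - F z) / norm (y - z) \<le> C" if "y \<in> S" "z \<in> S" "y \<noteq> z" for y z
  proof -
    have "spectral_norm (F y - F z) \<le> C * norm (y - z)"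
      using lipschitz_onD[OF C that(1,2)] spectral_norm_le_frobenius[of "F y - F z"]
      by (simp add: dist_norm)
    then show ?thesis using that by (simp add: pos_divide_le_eq)
  qed
  then have "bdd_above ((\<lambda>(y, z). spectral_norm (F y - F z) / norm (y - z)) `
      {(y, z). y \<in> S \<and> z \<in> S \<and> y \<noteq> z})"
    by (intro bdd_aboveI2[of _ _ C]) auto
  from cSUP_upper2[OF this, of "(y, z)"] show ?thesis
    unfolding lip_const_on_def using assms by auto
qed

lemma lip_const_on_bound:
  assumes "y \<in> S" "z \<in> S"
  shows "spectral_norm (F y - F z) \<le> lip_const_on S F * norm (y - z)"
proof (cases "y = z")
  case True
  then show ?thesis using spectral_norm_le_frobenius[of "F y - F z"] by simp
next
  case False
  then show ?thesis
    using difference_quotient_le_lip_const_on[OF assms] by (simp add: pos_divide_le_eq)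
qed

lemma lip_const_on_nonneg:
  assumes "y \<in> S" "z \<in> S" "y \<noteq> z"
  shows "0 \<le> lip_const_on S F"
  by (rule order_trans[OF divide_nonneg_nonneg[OF spectral_norm_nonneg norm_ge_zero]
        difference_quotient_le_lip_const_on[OF assms]])

end

text \<open>The usual product rule for Lipschitz functions, where compactness bounds both factors.\<close>

lemma lipschitz_on_matrix_mult:
  fixes F :: "'a::metric_space \<Rightarrow> real^'m^'k" and G :: "'a \<Rightarrow> real^'q^'m"
  assumes F: "CF-lipschitz_on S F" and G: "CG-lipschitz_on S G" and S: "compact S"
  obtains C where "C-lipschitz_on S (\<lambda>y. F y ** G y)"
proof -
  have bil: "bounded_bilinear ((**) :: real^'m^'k \<Rightarrow> real^'q^'m \<Rightarrow> real^'q^'k)"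
    unfolding bilinear_conv_bounded_bilinear[symmetric] bilinear_def
    by (auto intro!: linearI simp: matrix_matrix_mult_def vec_eq_iff sum.distrib algebra_simps sum_distrib_left)
  interpret bounded_bilinear "(**) :: real^'m^'k \<Rightarrow> real^'q^'m \<Rightarrow> real^'q^'k" by (rule bil)
  obtain K where K: "K \<ge> 0" "\<And>(a::real^'m^'k) (b::real^'q^'m). norm (a ** b) \<le> norm a * norm b * K"
    using nonneg_bounded by blast
  have "bounded (F ` S)" "bounded (G ` S)"
    using F G S by (auto intro!: compact_imp_bounded compact_continuous_image lipschitz_on_continuous_on)
  then obtain bF bG where b: "\<And>y. y \<in> S \<Longrightarrow> norm (F y) \<le> bF" "\<And>y. y \<in> S \<Longrightarrow> norm (G y) \<le> bG"
    unfolding bounded_iff by blast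
  let ?C = "(CF * \<bar>bG\<bar> + \<bar>bF\<bar> * CG) * K"
  have CF: "0 \<le> CF" and CG: "0 \<le> CG" using F G lipschitz_on_nonneg by auto
  have "?C-lipschitz_on S (\<lambda>y. F y ** G y)"
  proof (rule lipschitz_onI)
    fix y z assume yz: "y \<in> S" "z \<in> S"
    have "F y ** G y - F z ** G z = (F y - F z) ** G y + F z ** (G y - G z)"
      by (simp add: diff_left diff_right)
    then have "norm (F y ** G y - F z ** G z) \<le> norm (F y - F z) * norm (G y) * K + norm (F z) * norm (G y - G z) * K"
      by (metis K(2) norm_triangle_mono)
    also have "\<dots> \<le> (CF * dist y z) * \<bar>bG\<bar> * K + \<bar>bF\<bar> * (CG * dist y z) * K"
      using b[OF yz(1)] b[OF yz(2)] lipschitz_onD[OF F yz] lipschitz_onD[OF G yz] K(1) CF CG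
      by (intro add_mono mult_right_mono mult_mono) (auto simp: dist_norm)
    finally show "dist (F y ** G y) (F z ** G z) \<le> ?C * dist y z"
      by (simp add: dist_norm algebra_simps)
  qed (use K CF CG in auto)
  then show thesis by (rule that)
qed

text \<open>The mean value inequality for \<open>w \<mapsto> F w - transpose B *v w\<close>. It is used with \<open>B\<close> the transposed Jacobian at
either end of the segment.\<close>

lemma linearization_error:
  fixes F :: "real^'n \<Rightarrow> real^'m"
  assumes diff: "\<And>w. F differentiable (at w)"
    and K: "\<And>w. w \<in> closed_segment z y \<Longrightarrow> spectral_norm (tjac F w - B) \<le> K"
  shows "norm (F y - F z - transpose B *v (y - z)) \<le> K * norm (y - z)"
proof -
  have "norm ((F y - transpose B *v y) - (F z - transpose B *v z)) \<le> K * norm (y - z)"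
  proof (rule differentiable_bound[OF convex_closed_segment])
    fix w assume w: "w \<in> closed_segment z y"
    have "((\<lambda>w. F w - transpose B *v w) has_derivative
        (\<lambda>h. transpose (tjac F w) *v h - transpose B *v h)) (at w)"
      by (intro has_derivative_diff has_derivative_tjac diff bounded_linear_imp_has_derivative
          matrix_vector_mul_bounded_linear)
    moreover have "transpose (tjac F w) *v h - transpose B *v h = transpose (tjac F w - B) *v h" for h
      by (simp add: transpose_matrix_vector vector_matrix_mult_diff_rdistrib vector_matrix_mult_diff_distrib)
    ultimately show "((\<lambda>w. F w - transpose B *v w) has_derivative
        (\<lambda>h. transpose (tjac F w - B) *v h)) (at w within closed_segment z y)"
      by (simp add: has_derivative_at_withinI)
    show "onorm ((*v) (transpose (tjac F w - B))) \<le> K"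
      by (intro onorm_le norm_transpose_mult_le K[OF w] order_refl)
  qed auto
  then show ?thesis by (simp add: matrix_vector_mult_diff_distrib algebra_simps)
qed

section \<open>Feasibility and stationarity near a feasible point\<close>

context
  fixes c :: "real^'n \<Rightarrow> real^'p" and A :: "real^'n \<Rightarrow> real^'n" and X :: "(real^'n) set"
    and r :: nat and x :: "real^'n"
  assumes c_diff: "\<And>z. c differentiable (at z)" and c_lip: "locally_lipschitz (tjac c)"
    and r_pos: "1 \<le> r" and feas_X: "feasible c \<subseteq> interior X"
    and rk: "\<And>z. z \<in> X \<Longrightarrow> rank (tjac c z) = r"
    and x_feas: "x \<in> feasible c"
begin

lemma sing_val_constraint_pos: "z \<in> X \<Longrightarrow> 0 < sing_val r (tjac c z)"
  using sing_val_rank_pos[OF rk r_pos] .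

text \<open>The predicate whose greatest element is \<^const>\<open>rho\<close> at the fixed data. That this maximum is attained has
to be shown before anything is known about \<^const>\<open>rho\<close>.\<close>

definition admissible_radius :: "real \<Rightarrow> bool" where
  "admissible_radius \<rho> \<longleftrightarrow> 0 < \<rho> \<and> \<rho> \<le> 1 \<and> ball x \<rho> \<subseteq> X \<and>
     (INF y\<in>ball x \<rho>. sing_val r (tjac c y)) \<ge> sing_val r (tjac c x) / 2"

lemma admissible_radius_iff:
  "admissible_radius \<rho> \<longleftrightarrow> 0 < \<rho> \<and> \<rho> \<le> 1 \<and> ball x \<rho> \<subseteq> X \<and>
     (\<forall>y\<in>ball x \<rho>. sing_val r (tjac c x) / 2 \<le> sing_val r (tjac c y))"
proof (cases "0 < \<rho> \<and> ball x \<rho> \<subseteq> X")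
  case True
  have "bdd_below ((\<lambda>y. sing_val r (tjac c y)) ` ball x \<rho>)"
    using True sing_val_constraint_pos by (intro bdd_belowI2[of _ 0]) (meson less_imp_le subsetD)
  moreover have "ball x \<rho> \<noteq> {}" using True by simp
  ultimately have "(INF y\<in>ball x \<rho>. sing_val r (tjac c y)) \<ge> sing_val r (tjac c x) / 2 \<longleftrightarrow>
      (\<forall>y\<in>ball x \<rho>. sing_val r (tjac c x) / 2 \<le> sing_val r (tjac c y))"
    by (intro le_cINF_iff)
  then show ?thesis unfolding admissible_radius_def by blast
qed (auto simp: admissible_radius_def)

text \<open>On the \<open>r\<close>-dimensional subspace where \<open>tjac c x\<close> stretches by at least its \<open>r\<close>-th singular value \<open>s\<close>,
a perturbation of norm at most \<open>s / 2\<close> still stretches by \<open>s / 2\<close>.\<close>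

lemma admissible_radius_exists: "\<exists>\<rho>. admissible_radius \<rho>"
proof -
  let ?s = "sing_val r (tjac c x)"
  have xX: "x \<in> X" using x_feas feas_X interior_subset by blast
  have s: "?s > 0" using sing_val_constraint_pos[OF xX] .
  obtain r0 where r0: "r0 > 0" "ball x r0 \<subseteq> X"
    using x_feas feas_X mem_interior by blast
  obtain r1 L where r1: "r1 > 0" "L-lipschitz_on (ball x r1) (tjac c)"
    using c_lip unfolding locally_lipschitz_def by blast
  have L: "L \<ge> 0" using r1(2) by (rule lipschitz_on_nonneg)
  define \<rho> where "\<rho> = min (min 1 r0) (min r1 (?s / (2 * (L + 1))))"
  have \<rho>: "0 < \<rho>" "\<rho> \<le> 1" "\<rho> \<le> r0" "\<rho> \<le> r1" "\<rho> \<le> ?s / (2 * (L + 1))"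
    using s L r0 r1 by (auto simp: \<rho>_def)
  obtain V where V: "subspace V" "dim V = r" "\<And>u. u \<in> V \<Longrightarrow> ?s * norm u \<le> norm (tjac c x *v u)"
    using sing_val_rank_subspace[OF rk[OF xX] r_pos] by metis
  have "?s / 2 \<le> sing_val r (tjac c y)" if y: "y \<in> ball x \<rho>" for y
  proof (rule sing_val_ge_of_subspace[OF V(1) _ r_pos])
    fix u assume u: "u \<in> V"
    have "norm (tjac c x - tjac c y) \<le> L * dist x y"
      using lipschitz_onD[OF r1(2), of x y] y \<rho> r1(1) by (simp add: dist_norm)
    also have "\<dots> \<le> (L + 1) * (?s / (2 * (L + 1)))"
      using y \<rho> L by (intro mult_mono) auto
    also have "\<dots> = ?s / 2" using L by (simp add: field_simps)
    finally have "norm ((tjac c x - tjac c y) *v u) \<le> ?s / 2 * norm u"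
      by (meson norm_mult_le_frobenius mult_right_mono norm_ge_zero order_trans)
    moreover have "norm (tjac c x *v u) - norm ((tjac c x - tjac c y) *v u) \<le> norm (tjac c y *v u)"
      using norm_triangle_ineq2[of "tjac c x *v u" "tjac c y *v u"]
        norm_triangle_ineq2[of "tjac c x *v u" "(tjac c x - tjac c y) *v u"]
      by (simp add: matrix_vector_mult_diff_rdistrib)
    ultimately show "?s / 2 * norm u \<le> norm (tjac c y *v u)" using V(3)[OF u] by simp
  qed (use s V in auto)
  then have "admissible_radius \<rho>"
    unfolding admissible_radius_iff using \<rho> r0(2) by auto
  then show ?thesis ..
qed

text \<open>An open ball is the union of the smaller concentric open balls, and the requirements are pointwise on the
ball, so the supremum of the admissible radii is admissible.\<close>

lemma admissible_rho: "admissible_radius (rho c X r x)"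
proof -
  let ?R = "Sup {\<rho>. admissible_radius \<rho>}"
  have ne: "{\<rho>. admissible_radius \<rho>} \<noteq> {}" using admissible_radius_exists by blast
  have bdd: "bdd_above {\<rho>. admissible_radius \<rho>}"
    by (intro bdd_aboveI[of _ 1]) (simp add: admissible_radius_def)
  have upper: "\<rho> \<le> ?R" if "admissible_radius \<rho>" for \<rho>
    using that bdd by (intro cSup_upper) simp
  have "admissible_radius ?R"
    unfolding admissible_radius_iff[of ?R]
  proof (intro conjI)
    show "0 < ?R"
      using admissible_radius_exists upper by (meson admissible_radius_def less_le_trans)
    show "?R \<le> 1" using ne by (intro cSup_least) (simp_all add: admissible_radius_def)
    have "\<exists>\<rho>. admissible_radius \<rho> \<and> y \<in> ball x \<rho>" if "y \<in> ball x ?R" for y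
      using that less_cSup_iff[OF ne bdd] by auto
    then show "ball x ?R \<subseteq> X" "\<forall>y\<in>ball x ?R. sing_val r (tjac c x) / 2 \<le> sing_val r (tjac c y)"
      unfolding admissible_radius_iff by blast+
  qed
  moreover have "rho c X r x = (GREATEST \<rho>. admissible_radius \<rho>)"
    unfolding rho_def admissible_radius_def ..
  ultimately show ?thesis
    using Greatest_equality[of admissible_radius ?R] upper by simp
qed

text \<open>A nearest feasible point \<open>z\<close> satisfies \<open>norm (z - x) \<le> 2 norm (y - x)\<close>, which only puts it in the closed ball
of radius \<open>\<rho>\<close>, whereas the singular value bound holds on the open ball. Preferring \<open>x\<close> itself whenever it is a
nearest point makes the inequality strict in the other case.\<close>

lemma nearest_feasible_point:
  assumes y: "norm (y - x) \<le> rho c X r x / 2"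
  obtains z where "z \<in> feasible c" "\<And>w. w \<in> feasible c \<Longrightarrow> norm (y - z) \<le> norm (y - w)"
    "z \<in> ball x (rho c X r x)"
proof -
  have \<rho>: "0 < rho c X r x" using admissible_rho by (simp add: admissible_radius_def)
  have "closed (feasible c)"
  proof -
    have "continuous_on UNIV c"
      using c_diff differentiable_imp_continuous_within by (metis continuous_at_imp_continuous_on)
    then have "closed (c -` {0})" by (intro closed_vimage) auto
    then show ?thesis by (simp add: feasible_def vimage_def)
  qed
  then obtain z0 where z0: "z0 \<in> feasible c" "\<And>w. w \<in> feasible c \<Longrightarrow> norm (y - z0) \<le> norm (y - w)"
    using distance_attains_inf[of "feasible c" y] x_feas by (auto simp: dist_norm)
  show thesis
  proof (cases "norm (y - x) \<le> norm (y - z0)")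
    case True
    then show thesis using that[of x] z0 x_feas \<rho> by (auto intro: order_trans)
  next
    case False
    have "dist x z0 \<le> norm (y - x) + norm (y - z0)"
      using dist_triangle[of x z0 y] by (simp add: dist_norm norm_minus_commute)
    then show thesis using that[of z0] z0 y False by auto
  qed
qed

context
  assumes A_diff: "\<And>z. A differentiable (at z)" and A_lip: "locally_lipschitz (tjac A)"
    and A_id: "\<And>z. z \<in> feasible c \<Longrightarrow> A z = z"
    and A_kills: "\<And>z. z \<in> feasible c \<Longrightarrow> tjac A z ** tjac c z = 0"
begin

text \<open>This makes the constant \<open>L_b\<close> a genuine supremum, so that it is nonnegative and enlarging a denominator
by it only shrinks \<^const>\<open>eps\<close>.\<close>

lemma composite_lipschitz:
  assumes S: "compact S" "convex S"
  obtains C where "C-lipschitz_on S (\<lambda>y. tjac A y ** tjac c (A y))"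
proof -
  have "(sup_norm_on S (tjac A))-lipschitz_on S A" if "S \<noteq> {}"
  proof (rule lipschitz_onI)
    fix y z assume yz: "y \<in> S" "z \<in> S"
    have "norm (A y - A z) \<le> sup_norm_on S (tjac A) * norm (y - z)"
    proof (rule differentiable_bound[OF S(2) _ _ yz])
      fix w assume w: "w \<in> S"
      show "(A has_derivative (*v) (transpose (tjac A w))) (at w within S)"
        using has_derivative_tjac[OF A_diff] by (rule has_derivative_at_withinI)
      have "spectral_norm (tjac A w) \<le> sup_norm_on S (tjac A)"
        by (intro spectral_norm_le_sup_norm_on continuous_on_locally_lipschitz A_lip S w)
      then show "onorm ((*v) (transpose (tjac A w))) \<le> sup_norm_on S (tjac A)"
        by (intro onorm_le norm_transpose_mult_le order_refl)
    qed
    then show "dist (A y) (A z) \<le> sup_norm_on S (tjac A) * dist y z" by (simp add: dist_norm)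
  next
    obtain y where "y \<in> S" using \<open>S \<noteq> {}\<close> by blast
    then show "0 \<le> sup_norm_on S (tjac A)"
      by (meson spectral_norm_le_sup_norm_on continuous_on_locally_lipschitz A_lip S(1)
          spectral_norm_nonneg order_trans)
  qed
  then obtain CA where CA: "CA-lipschitz_on S A"
    using lipschitz_on_empty by (metis order_refl)
  then have "compact (A ` S)" using S(1) by (intro compact_continuous_image lipschitz_on_continuous_on)
  then obtain Lc where "Lc-lipschitz_on (A ` S) (tjac c)"
    using locally_lipschitz_compact[OF c_lip] by blast
  with CA have "(Lc * CA)-lipschitz_on S (\<lambda>y. tjac c (A y))" by (rule lipschitz_on_compose2)
  moreover obtain LA where "LA-lipschitz_on S (tjac A)"
    using locally_lipschitz_compact[OF A_lip S(1)] by blast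
  ultimately show thesis
    using lipschitz_on_matrix_mult[of LA S "tjac A"] S(1) that by metis
qed

text \<open>At \<open>z\<close> the composition of the derivatives of \<open>A\<close> and \<open>c\<close> vanishes, so near \<open>z\<close> the derivative of
\<open>w \<mapsto> transpose (tjac c y) *v A w\<close> is as small as the variation of the two Jacobians:
\<open>tjac A w ** tjac c y = (tjac A w - tjac A z) ** tjac c y + tjac A z ** (tjac c y - tjac c z)\<close>. If \<open>KA\<close>
and \<open>Kc\<close> are proportional to the distance of \<open>y\<close> and \<open>z\<close>, the estimate is quadratic in this distance.\<close>

lemma image_error:
  assumes z: "z \<in> feasible c"
    and KA: "\<And>w. w \<in> closed_segment z y \<Longrightarrow> spectral_norm (tjac A w - tjac A z) \<le> KA"
    and Kc: "spectral_norm (tjac c y - tjac c z) \<le> Kc"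
    and Mc: "spectral_norm (tjac c y) \<le> Mc" and MA: "spectral_norm (tjac A z) \<le> MA"
  shows "norm (transpose (tjac c y) *v (A y - z)) \<le> (KA * Mc + MA * Kc) * norm (y - z)"
proof -
  let ?J = "transpose (tjac c y)"
  have "norm (?J *v A y - ?J *v A z) \<le> (KA * Mc + MA * Kc) * norm (y - z)"
  proof (rule differentiable_bound[OF convex_closed_segment])
    fix w assume w: "w \<in> closed_segment z y"
    show "((\<lambda>w. ?J *v A w) has_derivative (\<lambda>h. ?J *v (transpose (tjac A w) *v h))) (at w within closed_segment z y)"
      using bounded_linear.has_derivative[OF matrix_vector_mul_bounded_linear has_derivative_tjac[OF A_diff]]
      by (rule has_derivative_at_withinI)
    show "onorm (\<lambda>h. ?J *v (transpose (tjac A w) *v h)) \<le> KA * Mc + MA * Kc"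
    proof (rule onorm_le)
      fix h
      have kill: "transpose (tjac c z) *v (transpose (tjac A z) *v h) = 0"
      proof -
        have "transpose (tjac c z) *v (transpose (tjac A z) *v h) = transpose (tjac A z ** tjac c z) *v h"
          by (simp only: matrix_transpose_mul matrix_vector_mul_assoc)
        also have "\<dots> = 0"
          by (simp add: A_kills[OF z] transpose_def matrix_vector_mult_def vec_eq_iff)
        finally show ?thesis .
      qed
      have split: "?J *v (transpose (tjac A w) *v h) =
          ?J *v (transpose (tjac A w - tjac A z) *v h)
          + transpose (tjac c y - tjac c z) *v (transpose (tjac A z) *v h)"
        using kill by (simp add: transpose_matrix_vector algebra_simps)
      have "norm (?J *v (transpose (tjac A w - tjac A z) *v h)) \<le> Mc * (KA * norm h)"
        by (intro norm_transpose_mult_le Mc KA[OF w] order_refl)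
      moreover have "norm (transpose (tjac c y - tjac c z) *v (transpose (tjac A z) *v h)) \<le> Kc * (MA * norm h)"
        by (intro norm_transpose_mult_le Kc MA order_refl)
      ultimately show "norm (?J *v (transpose (tjac A w) *v h)) \<le> (KA * Mc + MA * Kc) * norm h"
        unfolding split by (intro norm_triangle_le) (simp add: algebra_simps)
    qed
  qed auto
  then show ?thesis using A_id[OF z] by (simp add: matrix_vector_mult_diff_distrib)
qed

lemma times_le_of_ereal_quotient:
  assumes "ereal d \<le> ereal s / ereal K" "0 \<le> K" "0 < s"
  shows "d * K \<le> s"
proof (cases "K = 0")
  case False
  then have "K > 0" using assms(2) by simp
  moreover from this have "d \<le> s / K" using assms(1) by simp
  ultimately show ?thesis by (simp add: pos_le_divide_eq)
qed (use assms in simp)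

text \<open>Moving from \<open>y\<close> to \<open>A y\<close> is, to first order, a descent direction for the squared constraint violation.
Let \<open>z\<close> be a nearest feasible point and \<open>d = norm (y - z)\<close>. Since \<open>y - z\<close> is normal to the feasible set at \<open>z\<close>,
the bound on the singular values makes \<open>norm (c y)\<close> at least of order \<open>d\<close>. On the other hand,
\<open>transpose (tjac c y) *v (y - A y)\<close> equals \<open>c y\<close> up to an error \<open>e\<close> of order \<open>d\<^sup>2\<close>, by linearising \<open>c\<close> and by
\<open>image_error\<close>. The radius \<^const>\<open>eps\<close> is small enough for \<open>e\<close> to be shorter than \<open>c y\<close>, and then
\<open>(y - A y) \<bullet> (tjac c y *v c y) = (c y - e) \<bullet> c y\<close> is positive by the Cauchy-Schwarz inequality.\<close>

lemma descent_pairing_positive: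
  assumes y: "y \<in> Omega c A X r x" and infeasible: "c y \<noteq> 0"
  shows "0 < (y - A y) \<bullet> (tjac c y *v c y)"
proof -
  define T where "T = Theta c X r x"
  define \<rho> where "\<rho> = rho c X r x"
  define s where "s = sing_val r (tjac c x)"
  define Mc where "Mc = sup_norm_on T (tjac c)"
  define MA where "MA = sup_norm_on T (tjac A)"
  define Lc where "Lc = lip_const_on T (tjac c)"
  define LA where "LA = lip_const_on T (tjac A)"
  define Lb where "Lb = lip_const_on T (\<lambda>y. tjac A y ** tjac c (A y))"
  have \<rho>: "0 < \<rho>" "ball x \<rho> \<subseteq> X" "\<And>w. w \<in> ball x \<rho> \<Longrightarrow> s / 2 \<le> sing_val r (tjac c w)"
    using admissible_rho unfolding admissible_radius_iff \<rho>_def s_def by auto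
  have xX: "x \<in> X" using \<rho> by auto
  have s: "0 < s" unfolding s_def by (rule sing_val_constraint_pos[OF xX])
  have T: "T = cball x \<rho>" by (auto simp: T_def Theta_def \<rho>_def dist_norm norm_minus_commute)
  then have compT: "compact T" and convT: "convex T" by auto
  let ?bounds = "{ereal (\<rho> / 2), ereal s / ereal (32 * Lc * (MA + 1)),
    ereal (s\<^sup>2) / ereal (8 * (Lb + Lc) * Mc), ereal s / ereal (5 * (Lb + LA * Mc))}"
  have "ereal (norm (y - x)) \<le> Min ?bounds"
    using y unfolding Omega_def eps_def Let_def mem_Collect_eq
      \<rho>_def s_def Mc_def MA_def Lc_def LA_def Lb_def T_def .
  then have yb_le: "ereal (norm (y - x)) \<le> t" if "t \<in> ?bounds" for t
    using Min_le[OF _ that] by (meson finite.emptyI finite.insertI order_trans)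
  have yb: "ereal (norm (y - x)) \<le> ereal (\<rho> / 2)"
    "ereal (norm (y - x)) \<le> ereal s / ereal (32 * Lc * (MA + 1))"
    "ereal (norm (y - x)) \<le> ereal s / ereal (5 * (Lb + LA * Mc))"
    by (rule yb_le, blast)+
  obtain z where z: "z \<in> feasible c" "\<And>w. w \<in> feasible c \<Longrightarrow> norm (y - z) \<le> norm (y - w)" "z \<in> ball x \<rho>"
    using nearest_feasible_point[of y] yb(1) unfolding \<rho>_def by auto
  define d where "d = norm (y - z)"
  have cz: "c z = 0" using z(1) by (simp add: feasible_def)
  have d: "0 < d" using infeasible cz by (auto simp: d_def)
  have dle: "d \<le> norm (y - x)" unfolding d_def by (rule z(2)[OF x_feas])
  have yT: "y \<in> T" and zT: "z \<in> T" and yz: "y \<noteq> z"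
    using yb(1) z(3) \<rho>(1) d by (auto simp: T dist_norm norm_minus_commute d_def)
  have seg: "w \<in> T" "norm (w - z) \<le> d" "norm (w - y) \<le> d" if "w \<in> closed_segment z y" for w
    using that closed_segment_subset[OF zT yT convT] segment_bound[OF that]
    by (auto simp: d_def norm_minus_commute)
  obtain Cc where Cc: "Cc-lipschitz_on T (tjac c)" using locally_lipschitz_compact[OF c_lip compT] .
  obtain CA where CA: "CA-lipschitz_on T (tjac A)" using locally_lipschitz_compact[OF A_lip compT] .
  obtain Cb where Cb: "Cb-lipschitz_on T (\<lambda>y. tjac A y ** tjac c (A y))"
    using composite_lipschitz[OF compT convT] .
  have Lc: "0 \<le> Lc" and LA: "0 \<le> LA" and Lb: "0 \<le> Lb"
    unfolding Lc_def LA_def Lb_def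
    using lip_const_on_nonneg[OF Cc yT zT yz] lip_const_on_nonneg[OF CA yT zT yz] lip_const_on_nonneg[OF Cb yT zT yz]
    by auto
  have Mcy: "spectral_norm (tjac c y) \<le> Mc" and MAz: "spectral_norm (tjac A z) \<le> MA"
    unfolding Mc_def MA_def
    by (intro spectral_norm_le_sup_norm_on continuous_on_locally_lipschitz c_lip A_lip compT yT zT)+
  have Mc: "0 \<le> Mc" and MA: "0 \<le> MA"
    using Mcy MAz spectral_norm_nonneg order_trans by blast+
  have lipc: "spectral_norm (tjac c u - tjac c w) \<le> Lc * d" if "u \<in> T" "w \<in> T" "norm (u - w) \<le> d" for u w
    using lip_const_on_bound[OF Cc that(1,2)] mult_left_mono[OF that(3) Lc] unfolding Lc_def by linarith
  have lipA: "spectral_norm (tjac A u - tjac A w) \<le> LA * d" if "u \<in> T" "w \<in> T" "norm (u - w) \<le> d" for u w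
    using lip_const_on_bound[OF CA that(1,2)] mult_left_mono[OF that(3) LA] unfolding LA_def by linarith

  have "norm (c y - c z - transpose (tjac c z) *v (y - z)) \<le> (Lc * d) * d"
    by (rule linearization_error[OF c_diff, of z y "tjac c z" "Lc * d", folded d_def])
       (use seg zT lipc in auto)
  then have err_z: "norm (c y - transpose (tjac c z) *v (y - z)) \<le> Lc * d * d" using cz by simp
  have "norm (c y - c z - transpose (tjac c y) *v (y - z)) \<le> (Lc * d) * d"
    by (rule linearization_error[OF c_diff, of z y "tjac c y" "Lc * d", folded d_def])
       (use seg yT lipc in auto)
  then have err_y: "norm (c y - transpose (tjac c y) *v (y - z)) \<le> Lc * d * d" using cz by simp
  have err_A: "norm (transpose (tjac c y) *v (A y - z)) \<le> (LA * d * Mc + MA * (Lc * d)) * d"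
    by (rule image_error[OF z(1) _ _ Mcy MAz, folded d_def])
       (use seg lipA lipc zT yT d_def in auto)

  have "z \<in> interior X" using z(1) feas_X by blast
  then have normal: "y - z \<in> range ((*v) (tjac c z))"
    using nearest_point_normal[OF c_diff continuous_on_locally_lipschitz[OF c_lip] _ rk cz z(2)] by simp
  have "z \<in> X" using z(3) \<rho>(2) by blast
  then have "s / 2 * d \<le> norm (transpose (tjac c z) *v (y - z))"
    using sing_val_rank_range[OF rk[OF \<open>z \<in> X\<close>] r_pos normal]
      mult_right_mono[OF \<rho>(3)[OF z(3)], of d] d
    unfolding d_def by linarith
  then have lower: "(s / 2 - Lc * d) * d \<le> norm (c y)"
    using err_z norm_triangle_ineq2[of "transpose (tjac c z) *v (y - z)" "c y"]
    by (simp add: norm_minus_commute algebra_simps)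

  have small1: "d * (32 * Lc * (MA + 1)) \<le> s"
    using times_le_of_ereal_quotient[OF yb(2) _ s] mult_right_mono[OF dle, of "32 * Lc * (MA + 1)"] Lc MA
    by simp
  have small2: "d * (5 * (Lb + LA * Mc)) \<le> s"
    using times_le_of_ereal_quotient[OF yb(3) _ s] mult_right_mono[OF dle, of "5 * (Lb + LA * Mc)"] Lb LA Mc
    by simp
  \<comment> \<open>In units of \<open>s\<close> the error terms sum to at most \<open>2/32 + 1/5\<close>, which is less than \<open>1/2\<close>. The margin makes
    up for linearisation errors that are estimated without the factor \<open>1/2\<close> of Taylor's formula.\<close>
  have budget: "P + (R + Q) < s / 2 - P" if "32 * (P + Q) \<le> s" "5 * R \<le> s" "0 \<le> Q" for P Q R
    using that s by argo
  define \<eta> where "\<eta> = Lc * d + (LA * d * Mc + MA * (Lc * d))"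
  have "32 * (Lc * d + MA * (Lc * d)) \<le> s" using small1 by (simp add: algebra_simps)
  moreover have "5 * (LA * d * Mc) \<le> s"
  proof -
    have "0 \<le> d * Lb" using d Lb by simp
    then show ?thesis using small2 by (simp add: algebra_simps)
  qed
  moreover have "0 \<le> MA * (Lc * d)" using MA Lc d by simp
  ultimately have "\<eta> < s / 2 - Lc * d"
    unfolding \<eta>_def using budget by blast
  then have "\<eta> * d < (s / 2 - Lc * d) * d" using d by simp
  with lower have gap: "\<eta> * d < norm (c y)" by linarith

  define e where "e = c y - transpose (tjac c y) *v (y - A y)"
  have "e = (c y - transpose (tjac c y) *v (y - z)) + transpose (tjac c y) *v (A y - z)"
    by (simp add: e_def algebra_simps)
  then have "norm e \<le> Lc * d * d + (LA * d * Mc + MA * (Lc * d)) * d"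
    by (simp only:) (rule norm_triangle_mono[OF err_y err_A])
  also have "\<dots> = \<eta> * d" by (simp add: \<eta>_def distrib_right)
  finally have "norm e < norm (c y)" using gap by linarith
  have "e \<bullet> c y \<le> norm e * norm (c y)" by (rule norm_cauchy_schwarz)
  also have "\<dots> < norm (c y) * norm (c y)"
    using \<open>norm e < norm (c y)\<close> infeasible by (intro mult_strict_right_mono) auto
  finally have "e \<bullet> c y < c y \<bullet> c y" by (simp add: dot_square_norm power2_eq_square)
  moreover have "(y - A y) \<bullet> (tjac c y *v c y) = (c y - e) \<bullet> c y"
    using transpose_inner[of "tjac c y" "y - A y" "c y"] by (simp add: e_def)
  ultimately show ?thesis by (simp add: inner_diff_left)
qed

text \<open>Pairing the stationarity equation with \<open>A y - y\<close> says that the second quotient in the threshold at \<open>y\<close>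
is \<open>\<beta>\<close> itself, as soon as its denominator is not zero. So \<open>\<beta>\<close> could not exceed the supremum.\<close>

lemma feasible_of_stationary:
  assumes f_diff: "\<And>z. f differentiable (at z)"
    and \<beta>: "ereal \<beta> > beta_threshold f c A X r x"
    and y: "y \<in> Omega c A X r x" and stat: "stationary (constraint_dissolving f c A \<beta>) y"
  shows "c y = 0"
proof (rule ccontr)
  assume "c y \<noteq> 0"
  define N where "N = (y - A y) \<bullet> (tjac c y *v c y)"
  have N: "N > 0" unfolding N_def by (rule descent_pairing_positive[OF y \<open>c y \<noteq> 0\<close>])
  have "tjac A y *v grad f (A y) + \<beta> *\<^sub>R (tjac c y *v c y) = 0"
    using stat grad_constraint_dissolving[OF f_diff c_diff A_diff] by (simp add: stationary_def)
  then have "tjac A y *v grad f (A y) = - (\<beta> *\<^sub>R (tjac c y *v c y))" by (simp add: eq_neg_iff_add_eq_0)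
  then have num: "(A y - y) \<bullet> (tjac A y *v grad f (A y)) = \<beta> * N"
    by (simp add: N_def inner_diff_left algebra_simps)
  let ?m = "\<lambda>y. Max {ereal (2 * (f (A (A y)) - f (A y))) / ereal ((norm (c y))\<^sup>2 - (norm (c (A y)))\<^sup>2),
         ereal ((A y - y) \<bullet> (tjac A y *v grad f (A y))) / ereal ((y - A y) \<bullet> (tjac c y *v c y)),
         0}"
  have "ereal \<beta> = ereal ((A y - y) \<bullet> (tjac A y *v grad f (A y))) / ereal ((y - A y) \<bullet> (tjac c y *v c y))"
    unfolding num N_def[symmetric] using N by simp
  also have "\<dots> \<le> ?m y" by (intro Max_ge) auto
  also have "\<dots> \<le> beta_threshold f c A X r x"
    unfolding beta_threshold_def by (rule SUP_upper[OF y])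
  finally show False using \<beta> by simp
qed

text \<open>The transposed derivative of \<open>A\<close> fixes the tangent vectors, so a gradient annihilated by \<open>tjac A y\<close> is
orthogonal to all of them and lies in the column space of \<open>tjac c y\<close>.\<close>

lemma multiplier_of_reduced_gradient:
  assumes f_diff: "f differentiable (at y)"
    and y: "y \<in> feasible c" and red: "tjac A y *v grad f y = 0"
  shows "constrained_stationary f c y"
proof -
  have cy: "c y = 0" using y by (simp add: feasible_def)
  have "grad f y \<in> range ((*v) (tjac c y))"
  proof (rule orthogonal_kernel_transpose)
    fix v assume v: "transpose (tjac c y) *v v = 0"
    have "transpose (tjac A y) *v v = v"
      using tangent_fixed[OF c_diff continuous_on_locally_lipschitz[OF c_lip] _ rk cy v A_diff A_id]
        feas_X y by blast
    then have "grad f y \<bullet> v = (transpose (tjac A y) *v v) \<bullet> grad f y" by (simp add: inner_commute)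
    also have "\<dots> = v \<bullet> (tjac A y *v grad f y)" by (rule transpose_inner)
    finally show "grad f y \<bullet> v = 0" using red by simp
  qed
  then obtain l where "grad f y = tjac c y *v l" by blast
  also have "\<dots> = (\<Sum>i\<in>UNIV. (l $ i) *\<^sub>R grad (\<lambda>z. c z $ i) y)"
    by (simp add: matrix_mult_sum grad_component[OF c_diff] scalar_mult_eq_scaleR)
  finally show ?thesis using cy unfolding constrained_stationary_def by auto
qed

end

end

theorem theorem1:
  fixes f :: "real^'n \<Rightarrow> real"
    and c :: "real^'n \<Rightarrow> real^'p"
    and A :: "real^'n \<Rightarrow> real^'n"
    and X :: "(real^'n) set"
    and p' :: nat
    and x :: "real^'n"
    and \<beta> :: real
  assumes "locally_lipschitz f" and "\<And>z. f differentiable (at z)"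
    and "\<And>z. c differentiable (at z)" and "locally_lipschitz (tjac c)"
    and "1 \<le> p'" and "p' \<le> CARD('p)"
    and "feasible c \<subseteq> interior X" and "\<And>z. z \<in> X \<Longrightarrow> rank (tjac c z) = p'"
    and "\<And>z. A differentiable (at z)" and "locally_lipschitz (tjac A)"
    and "\<And>z. z \<in> feasible c \<Longrightarrow> A z = z"
    and "\<And>z. z \<in> feasible c \<Longrightarrow> tjac A z ** tjac c z = 0"
    and "x \<in> feasible c"
    and "ereal \<beta> > beta_threshold f c A X p' x"
  shows "\<forall>y \<in> Omega c A X p' x.
           stationary (constraint_dissolving f c A \<beta>) y \<longrightarrow> constrained_stationary f c y"
proof (intro ballI impI)
  fix y assume y: "y \<in> Omega c A X p' x" and stat: "stationary (constraint_dissolving f c A \<beta>) y"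
  have cy: "c y = 0"
    using feasible_of_stationary[where f=f and c=c and A=A and X=X and r=p' and x=x] assms y stat by blast
  then have feas: "y \<in> feasible c" by (simp add: feasible_def)
  have "tjac A y *v grad f y = 0"
    using stat grad_constraint_dissolving[OF assms(2,3,9), of \<beta> y] cy assms(11)[OF feas]
    by (simp add: stationary_def)
  then show "constrained_stationary f c y"
    using multiplier_of_reduced_gradient[where f=f and c=c and A=A and X=X and r=p' and x=x] assms feas by blast
qed

end
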